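(* If $E\in\mathcal A_4$, then for every $\sigma\in\,]0,1]$ and every $u\in\mathbb R^{V^{(0)}}$ there exists $v\in\mathcal L'(\mathcal F,u)$ such that $\widetilde{\mathcal E}_{\infty,\sigma,E}(v)=E(u)$.
   Context: Setting. Let $2\le N\le k$ be integers, $V^{(0)}=\{P_1,\dots,P_N\}$ a set of $N$ elements, and $\psi_1,\dots,\psi_k$ one-to-one maps defined on $V^{(0)}$; put $V^{(1)}=\bigcup_{i=1}^k\psi_i(V^{(0)})$. Assume $\psi_j(P_j)=P_j$ for $j=1,\dots,N$; $P_j\notin\psi_i(V^{(0)})$ for all $j=1,\dots,N$ and $i\ne j$; and $V^{(1)}$ is connected, i.e. for all $i,i'\in\{1,\dots,k\}$ there are indices $i_0=i,i_1,\dots,i_h=i'$ with $\psi_{i_{s-1}}(V^{(0)})\cap\psi_{i_s}(V^{(0)})\neq\emptyset$ for $s=1,\dots,h$. $\mathcal F$ is a fractal generated by these maps: a compact connected metric space with distance $d$ containing $V^{(0)}$, such that the $\psi_i$ extend to one-to-one maps $\mathcal F\to\mathcal F$ with $\mathcal F=\bigcup_{i=1}^k\psi_i(\mathcal F)$, $d(\psi_i(x),\psi_i(y))=\frac12 d(x,y)$ for all $x,y\in\mathcal F$, and, writing $\psi_{i_1,\dots,i_n}=\psi_{i_1}\circ\cdots\circ\psi_{i_n}$, $\psi_{i_1,\dots,i_n}(\mathcal F)\cap\psi_{i'_1,\dots,i'_n}(\mathcal F)=\psi_{i_1,\dots,i_n}(V^{(0)})\cap\psi_{i'_1,\dots,i'_n}(V^{(0)})$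 whenever $(i_1,\dots,i_n)\neq(i'_1,\dots,i'_n)$. Put $V^{(n)}=\bigcup_{i_1,\dots,i_n=1}^k\psi_{i_1,\dots,i_n}(V^{(0)})$ and $V^{(\infty)}=\bigcup_nV^{(n)}$ (the $V^{(n)}$ are increasing). $\mathbb R^{A}$ is the set of real functions on $A$, except that $\mathbb R^{\mathcal F}$ is the set of continuous functions $\mathcal F\to\mathbb R$. For $u\in\mathbb R^{V^{(0)}}$: $\mathcal L(u)=\{v\in\mathbb R^{V^{(1)}}: v=u\text{ on }V^{(0)}\}$ and $\mathcal L'(\mathcal F,u)=\{v\in\mathbb R^{\mathcal F}: v=u\text{ on }V^{(0)},\ \min u\le v\le\max u\}$. For $E:\mathbb R^{V^{(0)}}\to[0,+\infty[$ and $\theta>0$: $S_{(\theta)}(E)(v)=\sum_{i=1}^kE(\theta\, v\circ\psi_i)$ for $v\in\mathbb R^{V^{(1)}}$, and $\Lambda_{(\theta)}(E)(u)=\inf\{S_{(\theta)}(E)(v):v\in\mathcal L(u)\}$ for $u\in\mathbb R^{V^{(0)}}$. Class $\mathcal A_1$: all $E:\mathbb R^{V^{(0)}}\to[0,+\infty[$ such that (Q1) $E$ is convex; (Q2) $E(\pm u+c)=E(u)$ for every $u$ and every constant $c$; (Q3) $E(u)=0$ iff $u$ is constant; (Q4) for all real $a\ge b$, $E((u\wedge a)\vee b)\le E(u)$, with strict inequality if $u$ is nonconstant and $(u\wedge a)\vee b\ne u$. Class $\mathcal A_2$: all $E\in\mathcal A_1$ for which there exists $\widetilde E:\mathbb R^{V^{(0)}}\to[0,+\infty[$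 such that: $\widetilde E$ satisfies (Q1)–(Q4) except possibly the strictness in (Q4); $\widetilde E$ is $p$-homogeneous for some $p>0$ ($\widetilde E(tu)=|t|^p\widetilde E(u)$); there is $\rho>0$ with $\Lambda_{(1)}(\widetilde E)=\rho\widetilde E$; and $E(u)/\widetilde E(u)\to1$ as $u\to0$ ($u$ nonconstant). Class $\mathcal A_3$: all $E\in\mathcal A_1$ such that (Q5) if $u,v\in\mathbb R^{V^{(0)}}$, $v(P)\ge0$ for every $P$ with $u(P)=\min u$, and $v(P)=0$ for every $P$ with $u(P)>\min u$, then the right derivative $\frac{d}{dt}^{+}\big|_{t=0}E(u+tv)\le0$. Put $\mathcal A_4=\mathcal A_2\cap\mathcal A_3$. For $E\in\mathcal A_2$ and $\sigma>0$, $\bar\theta_{\sigma,E}:\mathbb R^{V^{(0)}}\to\,]0,+\infty[$ is the (continuous) function such that, for nonconstant $u$, $\bar\theta_{\sigma,E}(u)$ is the unique $\theta>0$ with $\Lambda_{(\theta)}(E)(u)=\sigma E(u)$, and $\bar\theta_{\sigma,E}(u)=(\sigma/\rho)^{1/p}$ for constant $u$. For $\bar\theta:\mathbb R^{V^{(0)}}\to\,]0,+\infty[$ continuous, define recursively for functions $v$ on $V^{(n)}$ or on a larger set: $\bar\theta_{,}(v)=1$ (empty index), $\bar\theta_{,i}(v)=\bar\theta(v|_{V^{(0)}})$, $\bar\theta_{,i_1,\dots,i_{n+1}}(v)=\bar\theta_{,i_2,\dots,i_{n+1}}\big(\bar\theta(v|_{V^{(0)}})\,v\circ\psi_{i_1}\big)\,\bar\theta(v|_{V^{(0)}})$.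 With $\bar\theta=\bar\theta_{\sigma,E}$ put $\widetilde{\mathcal E}_{n,\sigma,E}(v)=\frac1{\sigma^n}\sum_{i_1,\dots,i_n=1}^kE\big(\bar\theta_{,i_1,\dots,i_n}(v)\,v\circ\psi_{i_1,\dots,i_n}|_{V^{(0)}}\big)$. This sequence is nondecreasing in $n$, and $\widetilde{\mathcal E}_{\infty,\sigma,E}(v)=\lim_{n\to\infty}\widetilde{\mathcal E}_{n,\sigma,E}(v)\in[0,+\infty]$ for $v\in\mathbb R^{V^{(\infty)}}$, and for $v\in\mathbb R^{\mathcal F}$ via restriction to $V^{(\infty)}$. *)

theory Defs
  imports "HOL-Analysis.Analysis"
begin

text \<open>
  The space of real functions on a set \<open>A\<close> is represented by \<open>extensional A\<close>, so that two elements
  are equal iff they agree on \<open>A\<close>. Functionals on such a space have type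
  \<open>('a \<Rightarrow> real) \<Rightarrow> real\<close>; their values outside \<open>extensional A\<close> are irrelevant, and every argument
  passed to them is explicitly restricted to \<open>A\<close>.
  Throughout, \<open>V\<close> stands for the initial set of vertices.
\<close>

abbreviation real_funs :: "'a set \<Rightarrow> ('a \<Rightarrow> real) set" where
  "real_funs A \<equiv> extensional A"

definition const_on :: "'a set \<Rightarrow> ('a \<Rightarrow> real) \<Rightarrow> bool" where
  "const_on V u \<longleftrightarrow> (\<exists>c. \<forall>x\<in>V. u x = c)"


subsection \<open>The fractal\<close>

definition words :: "nat \<Rightarrow> nat \<Rightarrow> nat list set" where
  "words k n = {w. set w \<subseteq> {1..k} \<and> length w = n}"

text \<open>The list \<open>[i\<^sub>1, \<dots>, i\<^sub>n]\<close> encodes the multi-index of the composition applying \<open>\<psi> i\<^sub>n\<close> first.\<close>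

primrec psi_word :: "(nat \<Rightarrow> 'a \<Rightarrow> 'a) \<Rightarrow> nat list \<Rightarrow> 'a \<Rightarrow> 'a" where
  "psi_word \<psi> [] = id"
| "psi_word \<psi> (i # w) = \<psi> i \<circ> psi_word \<psi> w"

definition V_level :: "nat \<Rightarrow> (nat \<Rightarrow> 'a \<Rightarrow> 'a) \<Rightarrow> 'a set \<Rightarrow> nat \<Rightarrow> 'a set" where
  "V_level k \<psi> V n = (\<Union>w\<in>words k n. psi_word \<psi> w ` V)"

definition V_infty :: "nat \<Rightarrow> (nat \<Rightarrow> 'a \<Rightarrow> 'a) \<Rightarrow> 'a set \<Rightarrow> 'a set" where
  "V_infty k \<psi> V = (\<Union>n. V_level k \<psi> V n)"

definition V_zero :: "nat \<Rightarrow> (nat \<Rightarrow> 'a) \<Rightarrow> 'a set" where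
  "V_zero N P = P ` {1..N}"

text \<open>
  The maps on the initial vertices and their extensions to the fractal \<open>F\<close> are the same \<open>\<psi> i\<close>.
\<close>

locale fractal =
  fixes N k :: nat
    and P :: "nat \<Rightarrow> 'a::metric_space"
    and \<psi> :: "nat \<Rightarrow> 'a \<Rightarrow> 'a"
    and F :: "'a set"
  assumes N_ge_2: "2 \<le> N"
    and N_le_k: "N \<le> k"
    and P_inj: "inj_on P {1..N}"
    and psi_fix: "\<And>j. j \<in> {1..N} \<Longrightarrow> \<psi> j (P j) = P j"
    and P_notin: "\<And>i j. j \<in> {1..N} \<Longrightarrow> i \<in> {1..k} \<Longrightarrow> i \<noteq> j \<Longrightarrow> P j \<notin> \<psi> i ` V_zero N P"
    and chain: "\<And>i i'. i \<in> {1..k} \<Longrightarrow> i' \<in> {1..k} \<Longrightarrow>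
      \<exists>(h::nat) c. c 0 = i \<and> c h = i' \<and> (\<forall>s\<le>h. c s \<in> {1..k}) \<and>
        (\<forall>s\<in>{1..h}. \<psi> (c (s - 1)) ` V_zero N P \<inter> \<psi> (c s) ` V_zero N P \<noteq> {})"
    and F_compact: "compact F"
    and F_connected: "connected F"
    and V_zero_subset: "V_zero N P \<subseteq> F"
    and psi_inj: "\<And>i. i \<in> {1..k} \<Longrightarrow> inj_on (\<psi> i) F"
    and F_self_similar: "F = (\<Union>i\<in>{1..k}. \<psi> i ` F)"
    and psi_dist: "\<And>i x y. i \<in> {1..k} \<Longrightarrow> x \<in> F \<Longrightarrow> y \<in> F \<Longrightarrow>
      dist (\<psi> i x) (\<psi> i y) = dist x y / 2"
    and cell_inter: "\<And>n w w'. w \<in> words k n \<Longrightarrow> w' \<in> words k n \<Longrightarrow> w \<noteq> w' \<Longrightarrow>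
      psi_word \<psi> w ` F \<inter> psi_word \<psi> w' ` F
        = psi_word \<psi> w ` V_zero N P \<inter> psi_word \<psi> w' ` V_zero N P"


subsection \<open>Extensions of functions and renormalization\<close>

definition ext_L :: "nat \<Rightarrow> (nat \<Rightarrow> 'a \<Rightarrow> 'a) \<Rightarrow> 'a set \<Rightarrow> ('a \<Rightarrow> real) \<Rightarrow> ('a \<Rightarrow> real) set" where
  "ext_L k \<psi> V u = {v \<in> real_funs (V_level k \<psi> V 1). \<forall>x\<in>V. v x = u x}"

definition ext_L' :: "'a::metric_space set \<Rightarrow> 'a set \<Rightarrow> ('a \<Rightarrow> real) \<Rightarrow> ('a \<Rightarrow> real) set" where
  "ext_L' V F u = {v \<in> real_funs F. continuous_on F v \<and> (\<forall>x\<in>V. v x = u x) \<and>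
     (\<forall>x\<in>F. Min (u ` V) \<le> v x \<and> v x \<le> Max (u ` V))}"

definition S_energy :: "nat \<Rightarrow> (nat \<Rightarrow> 'a \<Rightarrow> 'a) \<Rightarrow> 'a set \<Rightarrow> real \<Rightarrow>
    (('a \<Rightarrow> real) \<Rightarrow> real) \<Rightarrow> ('a \<Rightarrow> real) \<Rightarrow> real" where
  "S_energy k \<psi> V \<theta> E v = (\<Sum>i=1..k. E (\<lambda>x\<in>V. \<theta> * v (\<psi> i x)))"

definition Renorm :: "nat \<Rightarrow> (nat \<Rightarrow> 'a \<Rightarrow> 'a) \<Rightarrow> 'a set \<Rightarrow> real \<Rightarrow>
    (('a \<Rightarrow> real) \<Rightarrow> real) \<Rightarrow> ('a \<Rightarrow> real) \<Rightarrow> real" where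
  "Renorm k \<psi> V \<theta> E u = (INF v\<in>ext_L k \<psi> V u. S_energy k \<psi> V \<theta> E v)"


subsection \<open>Classes of functionals\<close>

definition energy_nonneg :: "'a set \<Rightarrow> (('a \<Rightarrow> real) \<Rightarrow> real) \<Rightarrow> bool" where
  "energy_nonneg V E \<longleftrightarrow> (\<forall>u\<in>real_funs V. 0 \<le> E u)"

definition Q1 :: "'a set \<Rightarrow> (('a \<Rightarrow> real) \<Rightarrow> real) \<Rightarrow> bool" where
  "Q1 V E \<longleftrightarrow> (\<forall>u\<in>real_funs V. \<forall>v\<in>real_funs V. \<forall>t\<in>{0..1}.
     E (\<lambda>x\<in>V. (1 - t) * u x + t * v x) \<le> (1 - t) * E u + t * E v)"

definition Q2 :: "'a set \<Rightarrow> (('a \<Rightarrow> real) \<Rightarrow> real) \<Rightarrow> bool" where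
  "Q2 V E \<longleftrightarrow> (\<forall>u\<in>real_funs V. \<forall>c.
     E (\<lambda>x\<in>V. u x + c) = E u \<and> E (\<lambda>x\<in>V. - u x + c) = E u)"

definition Q3 :: "'a set \<Rightarrow> (('a \<Rightarrow> real) \<Rightarrow> real) \<Rightarrow> bool" where
  "Q3 V E \<longleftrightarrow> (\<forall>u\<in>real_funs V. E u = 0 \<longleftrightarrow> const_on V u)"

definition trunc_fun :: "'a set \<Rightarrow> real \<Rightarrow> real \<Rightarrow> ('a \<Rightarrow> real) \<Rightarrow> 'a \<Rightarrow> real" where
  "trunc_fun V a b u = (\<lambda>x\<in>V. max (min (u x) a) b)"

definition Q4_weak :: "'a set \<Rightarrow> (('a \<Rightarrow> real) \<Rightarrow> real) \<Rightarrow> bool" where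
  "Q4_weak V E \<longleftrightarrow> (\<forall>u\<in>real_funs V. \<forall>a b. b \<le> a \<longrightarrow> E (trunc_fun V a b u) \<le> E u)"

definition Q4 :: "'a set \<Rightarrow> (('a \<Rightarrow> real) \<Rightarrow> real) \<Rightarrow> bool" where
  "Q4 V E \<longleftrightarrow> Q4_weak V E \<and>
     (\<forall>u\<in>real_funs V. \<forall>a b. b \<le> a \<longrightarrow> \<not> const_on V u \<longrightarrow> trunc_fun V a b u \<noteq> u \<longrightarrow>
        E (trunc_fun V a b u) < E u)"

definition A1 :: "'a set \<Rightarrow> (('a \<Rightarrow> real) \<Rightarrow> real) set" where
  "A1 V = {E. energy_nonneg V E \<and> Q1 V E \<and> Q2 V E \<and> Q3 V E \<and> Q4 V E}"

definition homogeneous :: "'a set \<Rightarrow> real \<Rightarrow> (('a \<Rightarrow> real) \<Rightarrow> real) \<Rightarrow> bool" where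
  "homogeneous V p E \<longleftrightarrow> (\<forall>u\<in>real_funs V. \<forall>t. E (\<lambda>x\<in>V. t * u x) = \<bar>t\<bar> powr p * E u)"

definition asymp_at_zero ::
  "'a set \<Rightarrow> (('a \<Rightarrow> real) \<Rightarrow> real) \<Rightarrow> (('a \<Rightarrow> real) \<Rightarrow> real) \<Rightarrow> bool" where
  "asymp_at_zero V E E' \<longleftrightarrow> (\<forall>\<epsilon>>0. \<exists>\<delta>>0. \<forall>u\<in>real_funs V.
     \<not> const_on V u \<longrightarrow> (\<forall>x\<in>V. \<bar>u x\<bar> < \<delta>) \<longrightarrow> \<bar>E u / E' u - 1\<bar> < \<epsilon>)"

definition A2_witness :: "nat \<Rightarrow> (nat \<Rightarrow> 'a \<Rightarrow> 'a) \<Rightarrow> 'a set \<Rightarrow> (('a \<Rightarrow> real) \<Rightarrow> real) \<Rightarrow>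
    (('a \<Rightarrow> real) \<Rightarrow> real) \<Rightarrow> real \<Rightarrow> real \<Rightarrow> bool" where
  "A2_witness k \<psi> V E E' p \<rho> \<longleftrightarrow>
     energy_nonneg V E' \<and> Q1 V E' \<and> Q2 V E' \<and> Q3 V E' \<and> Q4_weak V E' \<and>
     0 < p \<and> homogeneous V p E' \<and>
     0 < \<rho> \<and> (\<forall>u\<in>real_funs V. Renorm k \<psi> V 1 E' u = \<rho> * E' u) \<and>
     asymp_at_zero V E E'"

definition A2 :: "nat \<Rightarrow> (nat \<Rightarrow> 'a \<Rightarrow> 'a) \<Rightarrow> 'a set \<Rightarrow> (('a \<Rightarrow> real) \<Rightarrow> real) set" where
  "A2 k \<psi> V = {E \<in> A1 V. \<exists>E' p \<rho>. A2_witness k \<psi> V E E' p \<rho>}"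

definition Q5 :: "'a set \<Rightarrow> (('a \<Rightarrow> real) \<Rightarrow> real) \<Rightarrow> bool" where
  "Q5 V E \<longleftrightarrow> (\<forall>u\<in>real_funs V. \<forall>v\<in>real_funs V.
     (\<forall>x\<in>V. u x = Min (u ` V) \<longrightarrow> 0 \<le> v x) \<longrightarrow>
     (\<forall>x\<in>V. u x > Min (u ` V) \<longrightarrow> v x = 0) \<longrightarrow>
     (\<exists>D. ((\<lambda>t. E (\<lambda>x\<in>V. u x + t * v x)) has_real_derivative D) (at_right 0) \<and> D \<le> 0))"

definition A3 :: "'a set \<Rightarrow> (('a \<Rightarrow> real) \<Rightarrow> real) set" where
  "A3 V = {E \<in> A1 V. Q5 V E}"

definition A4 :: "nat \<Rightarrow> (nat \<Rightarrow> 'a \<Rightarrow> 'a) \<Rightarrow> 'a set \<Rightarrow> (('a \<Rightarrow> real) \<Rightarrow> real) set" where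
  "A4 k \<psi> V = A2 k \<psi> V \<inter> A3 V"


subsection \<open>The nonlinear energies\<close>

text \<open>
  For \<open>V\<close> with at least two points, \<open>E\<close> determines the triple \<open>(E', p, \<rho>)\<close> on \<open>extensional V\<close>:
  for nonconstant \<open>u\<close> the ratio of \<open>E (t u)\<close> to \<open>t powr p * E' u\<close> tends to 1 as \<open>t\<close> decreases to 0,
  which fixes \<open>p\<close> and \<open>E' u\<close>, and then \<open>\<rho>\<close>. So the choice below is of a uniquely determined pair.
\<close>

definition A2_params ::
  "nat \<Rightarrow> (nat \<Rightarrow> 'a \<Rightarrow> 'a) \<Rightarrow> 'a set \<Rightarrow> (('a \<Rightarrow> real) \<Rightarrow> real) \<Rightarrow> real \<times> real" where
  "A2_params k \<psi> V E = (SOME (p, \<rho>). \<exists>E'. A2_witness k \<psi> V E E' p \<rho>)"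

definition theta_bar :: "nat \<Rightarrow> (nat \<Rightarrow> 'a \<Rightarrow> 'a) \<Rightarrow> 'a set \<Rightarrow> real \<Rightarrow>
    (('a \<Rightarrow> real) \<Rightarrow> real) \<Rightarrow> ('a \<Rightarrow> real) \<Rightarrow> real" where
  "theta_bar k \<psi> V \<sigma> E u =
     (if const_on V u then (case A2_params k \<psi> V E of (p, \<rho>) \<Rightarrow> (\<sigma> / \<rho>) powr (1 / p))
      else (THE \<theta>. 0 < \<theta> \<and> Renorm k \<psi> V \<theta> E u = \<sigma> * E u))"

text \<open>\<open>\<Theta>\<close> is any functional on \<open>extensional V\<close>; it is instantiated with \<open>theta_bar\<close> below.\<close>

primrec theta_word :: "(nat \<Rightarrow> 'a \<Rightarrow> 'a) \<Rightarrow> 'a set \<Rightarrow> (('a \<Rightarrow> real) \<Rightarrow> real) \<Rightarrow>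
    nat list \<Rightarrow> ('a \<Rightarrow> real) \<Rightarrow> real" where
  "theta_word \<psi> V \<Theta> [] v = 1"
| "theta_word \<psi> V \<Theta> (i # w) v =
     theta_word \<psi> V \<Theta> w (\<lambda>x. \<Theta> (restrict v V) * v (\<psi> i x)) * \<Theta> (restrict v V)"

definition energy_n :: "nat \<Rightarrow> (nat \<Rightarrow> 'a \<Rightarrow> 'a) \<Rightarrow> 'a set \<Rightarrow> real \<Rightarrow>
    (('a \<Rightarrow> real) \<Rightarrow> real) \<Rightarrow> nat \<Rightarrow> ('a \<Rightarrow> real) \<Rightarrow> real" where
  "energy_n k \<psi> V \<sigma> E n v = (1 / \<sigma> ^ n) *
     (\<Sum>w\<in>words k n.
        E (\<lambda>x\<in>V. theta_word \<psi> V (theta_bar k \<psi> V \<sigma> E) w v * v (psi_word \<psi> w x)))"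

definition energy_infty :: "nat \<Rightarrow> (nat \<Rightarrow> 'a \<Rightarrow> 'a) \<Rightarrow> 'a set \<Rightarrow> real \<Rightarrow>
    (('a \<Rightarrow> real) \<Rightarrow> real) \<Rightarrow> ('a \<Rightarrow> real) \<Rightarrow> ereal" where
  "energy_infty k \<psi> V \<sigma> E v = lim (\<lambda>n. ereal (energy_n k \<psi> V \<sigma> E n v))"

end

theory Submission
  imports Defs
begin

text \<open>
  Fix boundary data \<open>u\<close>, put \<open>\<theta> = \<Theta> u\<close>, and let \<open>z\<close> minimize the total energy of the first level
  over the functions with boundary values \<open>\<theta> u\<close>. By definition of \<open>\<theta>\<close> the minimum is \<open>\<sigma> E u\<close>,
  so \<open>z / \<theta>\<close> extends \<open>u\<close> to the first level, and the functions \<open>child u i = z \<circ> \<psi> i\<close> are the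
  boundary data of the same problem on the cells. Iterating this gives a function on all vertices
  whose energy equals \<open>E u\<close> at every level, hence also in the limit. The whole difficulty is that
  this function should be uniformly continuous, i.e. that its oscillation on the cells of level \<open>n\<close>
  tends to 0 uniformly. Then it extends to the closure of the vertices, which is the fractal,
  because nearby points lie in the same cell or in cells with a common vertex.

  The oscillation decays for two different reasons. Write \<open>\<theta>\<^sub>w\<close> for the product of the factors met
  on the way to the cell \<open>w\<close>, so that \<open>\<theta>\<^sub>w v \<circ> \<psi>\<^sub>w\<close> is the boundary datum (\<open>state w u\<close>) there. The
  energies of all data of level \<open>n\<close> add up to \<open>\<sigma> ^ n E u\<close>, so their oscillations are bounded.

  \<^item> If the oscillation of the datum is not small, then the next step contracts the oscillation of the
    solution by a fixed ratio. The reason is \<open>min_ext_osc_cell_less\<close>: no cell of a minimizer contains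
    both extreme values, because one of them would be taken in that cell at interior vertices only,
    and moving these inwards would lower the energy by strict truncation (Q4) at a linear rate in
    that cell, while (Q5) makes the price in the other cells of smaller order. Compactness makes
    the ratio uniform (\<open>uniform_contraction\<close>).

  \<^item> If the oscillation of the datum is small, then \<open>E\<close> is close to the \<open>p\<close>-homogeneous eigenfunctional
    \<open>E'\<close> and \<open>\<theta> powr p\<close> is close to \<open>\<sigma> / \<rho>\<close>. Here (Q5) yields \<open>p > 1\<close>, and a test function yields
    \<open>\<rho> < 1\<close>, so \<open>\<theta> powr p\<close> exceeds \<open>\<sigma> / \<rho>'\<close> for a fixed \<open>\<rho>' < 1\<close>. Since
    \<open>\<theta>\<^sub>w powr p\<close> times the \<open>p\<close>-th power of the oscillation of \<open>v\<close> is controlled by the energy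
    \<open>\<sigma> ^ n E u\<close>, a long run of such steps forces the oscillation down like a power of \<open>\<rho>'\<close>.

  The two regimes may alternate arbitrarily along a word. They are merged by raising the oscillation
  to a high power \<open>\<alpha>\<close>: then one inequality (\<open>child_osc_power_estimate\<close>) holds in both, and its
  iteration gives a geometric bound that depends on the level only (\<open>osc_val_uniform_decay\<close>).
\<close>

section \<open>Functions on a finite set\<close>

lemma compact_box:
  fixes S :: "'a \<Rightarrow> real set"
  assumes "\<And>x. compact (S x)"
  shows "compact {f. \<forall>x. f x \<in> S x}"
proof -
  have "compactin (product_topology (\<lambda>_. euclidean) UNIV) (PiE UNIV S)"
    using assms by (subst compactin_PiE) auto
  moreover have "PiE UNIV S = {f. \<forall>x. f x \<in> S x}"
    by auto
  ultimately show ?thesis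
    by (simp add: euclidean_product_topology)
qed

definition osc :: "'a set \<Rightarrow> ('a \<Rightarrow> real) \<Rightarrow> real" where
  "osc V f = Max (f ` V) - Min (f ` V)"

lemma osc_cong: "(\<And>x. x \<in> V \<Longrightarrow> f x = g x) \<Longrightarrow> osc V f = osc V g"
  unfolding osc_def by (metis image_cong)

lemma continuous_on_Max_image:
  fixes f :: "'b \<Rightarrow> 'c::topological_space \<Rightarrow> real"
  assumes "finite A" "A \<noteq> {}" "\<And>a. a \<in> A \<Longrightarrow> continuous_on S (f a)"
  shows "continuous_on S (\<lambda>z. Max ((\<lambda>a. f a z) ` A))"
  using assms
proof (induction A rule: finite_ne_induct)
  case (insert a A)
  have "continuous_on S (\<lambda>z. max (f a z) (Max ((\<lambda>a. f a z) ` A)))"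
    using insert by (intro continuous_on_max) auto
  then show ?case
    using insert by simp
qed simp

lemma continuous_on_Min_image:
  fixes f :: "'b \<Rightarrow> 'c::topological_space \<Rightarrow> real"
  assumes "finite A" "A \<noteq> {}" "\<And>a. a \<in> A \<Longrightarrow> continuous_on S (f a)"
  shows "continuous_on S (\<lambda>z. Min ((\<lambda>a. f a z) ` A))"
  using assms
proof (induction A rule: finite_ne_induct)
  case (insert a A)
  have "continuous_on S (\<lambda>z. min (f a z) (Min ((\<lambda>a. f a z) ` A)))"
    using insert by (intro continuous_on_min) auto
  then show ?case
    using insert by simp
qed simp

lemma continuous_on_osc:
  fixes z :: "'c::topological_space \<Rightarrow> 'a \<Rightarrow> real"
  assumes "finite V" "V \<noteq> {}" "\<And>x. x \<in> V \<Longrightarrow> continuous_on S (\<lambda>c. z c x)"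
  shows "continuous_on S (\<lambda>c. osc V (z c))"
  unfolding osc_def using assms
  by (intro continuous_intros continuous_on_Max_image continuous_on_Min_image) auto

locale finite_set =
  fixes V :: "'a set"
  assumes finV: "finite V" and neV: "V \<noteq> {}"
begin

lemma Min_le_at: "x \<in> V \<Longrightarrow> Min (f ` V) \<le> (f x :: real)"
  using finV by simp

lemma le_Max_at: "x \<in> V \<Longrightarrow> (f x :: real) \<le> Max (f ` V)"
  using finV by simp

lemma Min_attained: obtains x where "x \<in> V" "f x = (Min (f ` V) :: real)"
proof -
  have "Min (f ` V) \<in> f ` V" using finV neV by (intro Min_in) auto
  then show thesis using that by force
qed

lemma Max_attained: obtains x where "x \<in> V" "f x = (Max (f ` V) :: real)"
proof -
  have "Max (f ` V) \<in> f ` V" using finV neV by (intro Max_in) auto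
  then show thesis using that by force
qed

lemma diff_le_osc: "x \<in> V \<Longrightarrow> y \<in> V \<Longrightarrow> f x - f y \<le> osc V f"
  unfolding osc_def using Min_le_at[of y f] le_Max_at[of x f] by linarith

lemma osc_attained: obtains x y where "x \<in> V" "y \<in> V" "f x - f y = osc V f"
  unfolding osc_def using Max_attained[of f] Min_attained[of f] by metis

lemma osc_leI: "(\<And>x y. x \<in> V \<Longrightarrow> y \<in> V \<Longrightarrow> f x - f y \<le> c) \<Longrightarrow> osc V f \<le> c"
  using osc_attained[of f] by metis

lemma osc_nonneg: "0 \<le> osc V f"
  using diff_le_osc[of _ _ f] neV by fastforce

lemma osc_affine: "0 \<le> t \<Longrightarrow> osc V (\<lambda>x. t * f x + c) = t * osc V f"
proof -
  assume t: "0 \<le> t"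
  obtain x y where xy: "x \<in> V" "y \<in> V" "f x - f y = osc V f" by (rule osc_attained)
  show ?thesis
  proof (rule antisym)
    show "osc V (\<lambda>x. t * f x + c) \<le> t * osc V f"
      using diff_le_osc[of _ _ f] t
      by (intro osc_leI) (simp add: right_diff_distrib[symmetric] mult_left_mono)
    show "t * osc V f \<le> osc V (\<lambda>x. t * f x + c)"
      using diff_le_osc[OF xy(1,2), of "\<lambda>x. t * f x + c"] xy(3)[symmetric]
      by (simp add: right_diff_distrib)
  qed
qed

lemma osc_scale: "0 \<le> t \<Longrightarrow> osc V (\<lambda>x. t * f x) = t * osc V f"
  using osc_affine[of t f 0] by simp

lemma const_on_iff_osc: "const_on V f \<longleftrightarrow> osc V f = 0"
proof
  assume "const_on V f"
  then have "osc V f \<le> 0" unfolding const_on_def by (intro osc_leI) auto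
  then show "osc V f = 0" using osc_nonneg[of f] by simp
next
  assume 0: "osc V f = 0"
  obtain a where a: "a \<in> V" using neV by auto
  have "f x = f a" if "x \<in> V" for x
    using diff_le_osc[of x a f] diff_le_osc[of a x f] that a 0 by simp
  then show "const_on V f" unfolding const_on_def by blast
qed

lemma osc_pos_iff: "0 < osc V f \<longleftrightarrow> \<not> const_on V f"
  using const_on_iff_osc[of f] osc_nonneg[of f] by linarith

end

section \<open>Convex energies on a finite set\<close>

locale energy = finite_set V for V :: "'a set" +
  fixes E :: "('a \<Rightarrow> real) \<Rightarrow> real"
  assumes nonneg: "energy_nonneg V E" and Q1: "Q1 V E" and Q2: "Q2 V E" and Q3: "Q3 V E"
    and Q4w: "Q4_weak V E"
begin

text \<open>The extension of \<open>E\<close> to all functions, through restriction to \<open>V\<close>. It is continuous for the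
  product topology, in which boxes are compact.\<close>

definition en :: "('a \<Rightarrow> real) \<Rightarrow> real" where
  "en f = E (restrict f V)"

lemma en_cong: "(\<And>x. x \<in> V \<Longrightarrow> f x = g x) \<Longrightarrow> en f = en g"
  unfolding en_def by (metis restrict_ext)

lemma en_extensional: "u \<in> extensional V \<Longrightarrow> en u = E u"
  by (simp add: en_def extensional_restrict)

lemma en_nonneg: "0 \<le> en f"
  using nonneg unfolding en_def energy_nonneg_def by simp

lemma en_convex:
  assumes "0 \<le> t" "t \<le> 1"
  shows "en (\<lambda>x. (1 - t) * f x + t * g x) \<le> (1 - t) * en f + t * en g"
proof -
  have "E (\<lambda>x\<in>V. (1 - t) * restrict f V x + t * restrict g V x)
      \<le> (1 - t) * E (restrict f V) + t * E (restrict g V)"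
    using Q1 assms unfolding Q1_def by (meson atLeastAtMost_iff restrict_extensional)
  moreover have "(\<lambda>x\<in>V. (1 - t) * restrict f V x + t * restrict g V x)
      = restrict (\<lambda>x. (1 - t) * f x + t * g x) V"
    by (rule restrict_ext) simp
  ultimately show ?thesis by (simp only: en_def)
qed

lemma en_shift: "en (\<lambda>x. f x + c) = en f"
proof -
  have "E (\<lambda>x\<in>V. restrict f V x + c) = E (restrict f V)"
    using Q2 unfolding Q2_def by (meson restrict_extensional)
  moreover have "(\<lambda>x\<in>V. restrict f V x + c) = restrict (\<lambda>x. f x + c) V"
    by (rule restrict_ext) simp
  ultimately show ?thesis by (simp only: en_def)
qed

lemma en_uminus: "en (\<lambda>x. - f x) = en f"
proof -
  have "E (\<lambda>x\<in>V. - restrict f V x + 0) = E (restrict f V)"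
    using Q2 unfolding Q2_def by (meson restrict_extensional)
  moreover have "(\<lambda>x\<in>V. - restrict f V x + 0) = restrict (\<lambda>x. - f x) V"
    by (rule restrict_ext) simp
  ultimately show ?thesis by (simp only: en_def)
qed

lemma en_zero_iff: "en f = 0 \<longleftrightarrow> const_on V f"
  using Q3 unfolding Q3_def en_def const_on_def by auto

lemma en_pos_iff: "0 < en f \<longleftrightarrow> \<not> const_on V f"
  using en_zero_iff[of f] en_nonneg[of f] by linarith

lemma en_trunc:
  assumes "b \<le> a"
  shows "en (\<lambda>x. max (min (f x) a) b) \<le> en f"
proof -
  have "trunc_fun V a b (restrict f V) = restrict (\<lambda>x. max (min (f x) a) b) V"
    unfolding trunc_fun_def by (auto simp: restrict_def)
  then show ?thesis
    using Q4w assms unfolding Q4_weak_def en_def by (metis restrict_extensional)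
qed

lemma en_scale_le:
  assumes "0 \<le> t" "t \<le> 1"
  shows "en (\<lambda>x. t * f x) \<le> t * en f"
proof -
  have "en (\<lambda>x. (1 - t) * 0 + t * f x) \<le> (1 - t) * en (\<lambda>_. 0) + t * en f"
    using en_convex[OF assms, of "\<lambda>_. 0" f] by simp
  moreover have "en (\<lambda>_. 0) = 0"
    by (simp add: en_zero_iff const_on_def)
  ultimately show ?thesis by simp
qed

text \<open>A convex function on a cube is bounded by its values at the vertices: free the coordinates
  one at a time, each value in between being a convex combination of the two extreme ones.\<close>

lemma en_bounded_cube:
  assumes "0 < R"
  obtains B where "\<And>f. (\<And>x. x \<in> V \<Longrightarrow> \<bar>f x\<bar> \<le> R) \<Longrightarrow> en f \<le> B"
proof -
  define C where "C = PiE V (\<lambda>_. {-R, R})"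
  have finC: "finite C" unfolding C_def using finV by (intro finite_PiE) auto
  define B where "B = Max (en ` C)"
  have "en f \<le> B" if "A \<subseteq> V" "\<forall>x\<in>A. \<bar>f x\<bar> \<le> R" "\<forall>x\<in>V - A. f x \<in> {-R, R}" for f A
    using finite_subset[OF that(1) finV] that
  proof (induction A arbitrary: f rule: finite_induct)
    case empty
    then have "restrict f V \<in> C" unfolding C_def by auto
    then have "en (restrict f V) \<le> B" unfolding B_def using finC by simp
    then show ?case using en_cong[of f "restrict f V"] by simp
  next
    case (insert a A)
    define t where "t = (f a + R) / (2 * R)"
    have t: "0 \<le> t" "t \<le> 1"
      using insert.prems(2) \<open>0 < R\<close> unfolding t_def by (auto simp: field_simps)
    have "f a = (1 - t) * (-R) + t * R"
      using \<open>0 < R\<close> unfolding t_def by (simp add: field_simps)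
    then have "f = (\<lambda>x. (1 - t) * (f(a := -R)) x + t * (f(a := R)) x)"
      by (auto simp: algebra_simps)
    then have "en f \<le> (1 - t) * en (f(a := -R)) + t * en (f(a := R))"
      using en_convex[OF t, of "f(a := -R)" "f(a := R)"] by simp
    also have "\<dots> \<le> (1 - t) * B + t * B"
      using t insert by (intro add_mono mult_left_mono insert.IH) auto
    finally show ?case by (simp add: algebra_simps)
  qed
  then show thesis using that[of B] by blast
qed

lemma en_bounded_osc:
  obtains B where "0 < B" "\<And>f. osc V f \<le> R \<Longrightarrow> en f \<le> B"
proof -
  have "0 < max R 1" by simp
  from en_bounded_cube[OF this]
  obtain B where B: "\<And>f. (\<And>x. x \<in> V \<Longrightarrow> \<bar>f x\<bar> \<le> max R 1) \<Longrightarrow> en f \<le> B"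
    by metis
  have "en f \<le> max B 1" if "osc V f \<le> R" for f
  proof -
    obtain y where y: "y \<in> V" "f y = Min (f ` V)" by (rule Min_attained)
    have "en (\<lambda>x. f x + (- f y)) \<le> B"
      using diff_le_osc[OF _ y(1), of _ f] Min_le_at[of _ f] that y
      by (intro B) (force simp: abs_if)
    then show ?thesis unfolding en_shift by simp
  qed
  then show thesis using that[of "max B 1"] by simp
qed

text \<open>A function at distance at most \<open>d\<close> from \<open>f\<close> divides the segment from \<open>f\<close> to an element of the larger cube in
  the ratio \<open>d : 1 - d\<close>.\<close>

lemma en_lipschitz:
  assumes B: "\<And>f. (\<And>x. x \<in> V \<Longrightarrow> \<bar>f x\<bar> \<le> R + 1) \<Longrightarrow> en f \<le> B"
    and f: "\<And>x. x \<in> V \<Longrightarrow> \<bar>f x\<bar> \<le> R" and d: "0 < d" "d \<le> 1"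
    and g: "\<And>x. x \<in> V \<Longrightarrow> \<bar>g x - f x\<bar> \<le> d"
  shows "en g \<le> en f + d * B"
proof -
  define h where "h x = f x + (g x - f x) / d" for x
  have "(1 - d) * f x + d * h x = g x" for x
    unfolding h_def using d by (simp add: field_simps)
  then have "en g \<le> (1 - d) * en f + d * en h"
    using en_convex[of d f h] d by simp
  also have "en h \<le> B"
  proof (rule B)
    fix x assume x: "x \<in> V"
    have "\<bar>(g x - f x) / d\<bar> \<le> 1" using g[OF x] d by simp
    then show "\<bar>h x\<bar> \<le> R + 1" unfolding h_def using f[OF x] by linarith
  qed
  also have "(1 - d) * en f \<le> en f" using d en_nonneg[of f] by (simp add: algebra_simps)
  finally show ?thesis using d by simp
qed

lemma continuous_on_en: "continuous_on UNIV en"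
  unfolding continuous_on_def
proof
  fix f :: "'a \<Rightarrow> real"
  define R where "R = 1 + Max ((\<lambda>x. \<bar>f x\<bar>) ` V)"
  have "0 \<le> Max ((\<lambda>x. \<bar>f x\<bar>) ` V)"
    using Max_attained[of "\<lambda>x. \<bar>f x\<bar>"] by (metis abs_ge_zero)
  then have "0 < R + 1" unfolding R_def by linarith
  then obtain B0 where B0: "\<And>f. (\<And>x. x \<in> V \<Longrightarrow> \<bar>f x\<bar> \<le> R + 1) \<Longrightarrow> en f \<le> B0"
    using en_bounded_cube[of "R + 1"] by auto
  define B where "B = max B0 1"
  have B: "\<And>f. (\<And>x. x \<in> V \<Longrightarrow> \<bar>f x\<bar> \<le> R + 1) \<Longrightarrow> en f \<le> B"
    using B0 unfolding B_def by (meson max.coboundedI1)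
  have "B > 0" unfolding B_def by simp
  have fR: "\<bar>f x\<bar> \<le> R - 1" if "x \<in> V" for x
    unfolding R_def using le_Max_at[OF that, of "\<lambda>x. \<bar>f x\<bar>"] by simp
  show "(en \<longlongrightarrow> en f) (at f within UNIV)"
  proof (rule tendstoI)
    fix e :: real assume "0 < e"
    define d where "d = min 1 (e / (2 * B))"
    have d: "0 < d" "d \<le> 1" "d * B < e"
    proof -
      show "0 < d" "d \<le> 1" unfolding d_def using \<open>0 < e\<close> \<open>B > 0\<close> by auto
      have "d \<le> e / (2 * B)" unfolding d_def by simp
      then have "d * B \<le> e / 2" using \<open>B > 0\<close> by (simp add: field_simps)
      then show "d * B < e" using \<open>0 < e\<close> by simp
    qed
    have "\<forall>\<^sub>F g in at f. \<forall>x\<in>V. dist (g x) (f x) < d"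
    proof (rule eventually_ball_finite[OF finV], rule ballI)
      fix x
      have "((\<lambda>g. g x) \<longlongrightarrow> f x) (at f)"
        using continuous_on_product_coordinates[of x] unfolding continuous_on_def by auto
      then show "\<forall>\<^sub>F g in at f. dist (g x) (f x) < d" using d(1) by (rule tendstoD)
    qed
    then show "\<forall>\<^sub>F g in at f. dist (en g) (en f) < e"
    proof eventually_elim
      case (elim g)
      then have gf: "\<bar>g x - f x\<bar> \<le> d" if "x \<in> V" for x
        using that by (auto simp: dist_real_def intro: less_imp_le)
      have gR: "\<bar>g x\<bar> \<le> R" if "x \<in> V" for x using gf[OF that] fR[OF that] d by linarith
      have "en g \<le> en f + d * B"
        using fR by (intro en_lipschitz[OF B _ d(1,2) gf]) force+
      moreover have "en f \<le> en g + d * B"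
        using gf gR by (intro en_lipschitz[OF B _ d(1,2)]) (auto simp: abs_minus_commute)
      ultimately show ?case using d(3) by (simp add: dist_real_def)
    qed
  qed
qed

text \<open>On the functions of oscillation exactly \<open>a\<close>, normalized to have minimum 0, the energy has a
  positive minimum by compactness; convexity spreads the bound to all larger oscillations.\<close>

lemma en_coercive:
  assumes "0 < a"
  obtains e where "0 < e" "\<And>f. a \<le> osc V f \<Longrightarrow> e * osc V f \<le> en f"
proof -
  define S where "S x = (if x \<in> V then {0..a} else {0::real})" for x
  define K where "K = {f. \<forall>x. f x \<in> S x} \<inter> {f. a \<le> osc V f}"
  have "compact {f. \<forall>x. f x \<in> S x}" by (rule compact_box) (simp add: S_def)
  moreover have "closed {f. a \<le> osc V f}"
    by (intro closed_Collect_le continuous_on_osc finV neV) auto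
  ultimately have K: "compact K" unfolding K_def by (rule compact_Int_closed)
  obtain e0 where e0: "0 < e0" "\<And>f. f \<in> K \<Longrightarrow> e0 \<le> en f"
  proof (cases "K = {}")
    case True then show thesis using that[of 1] by simp
  next
    case False
    obtain f0 where f0: "f0 \<in> K" "\<And>f. f \<in> K \<Longrightarrow> en f0 \<le> en f"
      using continuous_attains_inf[OF K False continuous_on_subset[OF continuous_on_en]] by auto
    have "0 < en f0" using f0(1) \<open>0 < a\<close> unfolding K_def en_pos_iff osc_pos_iff[symmetric] by simp
    then show thesis using that f0(2) by blast
  qed
  have "e0 / a * osc V f \<le> en f" if "a \<le> osc V f" for f
  proof -
    let ?s = "osc V f"
    have s: "0 < ?s" using that \<open>0 < a\<close> by simp
    define t where "t = a / ?s"
    have t: "0 \<le> t" "t \<le> 1" unfolding t_def using that \<open>0 < a\<close> by auto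
    define g where "g x = (if x \<in> V then t * (f x - Min (f ` V)) else 0)" for x
    have gV: "g x = t * f x + (- t * Min (f ` V))" if "x \<in> V" for x
      unfolding g_def using that by (simp add: algebra_simps)
    have "osc V g = osc V (\<lambda>x. t * f x + (- t * Min (f ` V)))" by (rule osc_cong[OF gV])
    also have "\<dots> = t * ?s" by (rule osc_affine[OF t(1)])
    finally have og: "osc V g = a" unfolding t_def using s by simp
    have "g x \<in> {0..a}" if "x \<in> V" for x
    proof -
      obtain y where y: "y \<in> V" "f y = Min (f ` V)" by (rule Min_attained)
      have "t * (f x - Min (f ` V)) \<le> t * ?s"
        using diff_le_osc[OF that y(1), of f] y(2) t by (intro mult_left_mono) auto
      also have "t * ?s = a" unfolding t_def using s by simp
      finally show ?thesis
        unfolding g_def using that Min_le_at[OF that, of f] t by simp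
    qed
    then have "g \<in> K" unfolding K_def S_def using og by (simp add: g_def)
    then have "e0 \<le> en g" by (rule e0)
    also have "en g = en (\<lambda>x. t * f x + (- t * Min (f ` V)))" by (rule en_cong[OF gV])
    also have "\<dots> = en (\<lambda>x. t * f x)" by (rule en_shift)
    also have "\<dots> \<le> t * en f" by (rule en_scale_le[OF t])
    finally show ?thesis unfolding t_def using s \<open>0 < a\<close> by (simp add: field_simps)
  qed
  then show thesis using that[of "e0 / a"] e0(1) \<open>0 < a\<close> by simp
qed

end


section \<open>Harmonic extension to the first level\<close>

context fractal
begin

abbreviation V0 :: "'a set" where "V0 \<equiv> V_zero N P"
abbreviation V1 :: "'a set" where "V1 \<equiv> V_level k \<psi> V0 1"

sublocale finite_set V0
  using N_ge_2 by unfold_locales (auto simp: V_zero_def)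

lemma P_in_V0: "j \<in> {1..N} \<Longrightarrow> P j \<in> V0"
  by (simp add: V_zero_def)

lemma V1_eq: "V1 = (\<Union>i\<in>{1..k}. \<psi> i ` V0)"
proof -
  have "words k 1 = (\<lambda>i. [i]) ` {1..k}"
    by (auto simp: words_def length_Suc_conv)
  then show ?thesis by (simp add: V_level_def)
qed

lemma psi_in_V1: "i \<in> {1..k} \<Longrightarrow> x \<in> V0 \<Longrightarrow> \<psi> i x \<in> V1"
  unfolding V1_eq by auto

lemma V0_subset_V1: "V0 \<subseteq> V1"
proof
  fix x assume "x \<in> V0"
  then obtain j where j: "j \<in> {1..N}" "x = P j" by (auto simp: V_zero_def)
  then have "\<psi> j x \<in> V1" using N_le_k by (intro psi_in_V1 \<open>x \<in> V0\<close>) auto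
  then show "x \<in> V1" using j psi_fix by simp
qed

lemma psi_in_F: "i \<in> {1..k} \<Longrightarrow> x \<in> F \<Longrightarrow> \<psi> i x \<in> F"
  using F_self_similar by blast

text \<open>A cell meets the boundary in its own fixed vertex at most.\<close>

lemma psi_corner:
  assumes "i \<in> {1..k}" "x \<in> V0" "\<psi> i x \<in> V0"
  shows "i \<in> {1..N}" "x = P i" "\<psi> i x = P i"
proof -
  obtain j where j: "j \<in> {1..N}" "\<psi> i x = P j" using assms(3) by (auto simp: V_zero_def)
  have ij: "i = j" using P_notin[OF j(1) assms(1)] j(2) assms(2) by (metis imageI)
  then show i: "i \<in> {1..N}" and "\<psi> i x = P i" using j by auto
  have "\<psi> i x = \<psi> i (P i)" using j(2) ij psi_fix[OF i] by simp
  then show "x = P i"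
    using psi_inj[OF assms(1)] assms(2) P_in_V0[OF i] V_zero_subset by (meson inj_onD subsetD)
qed

end

locale fractal_energy = fractal N k P \<psi> F + energy "V_zero N P" E
  for N k :: nat and P :: "nat \<Rightarrow> 'a::metric_space" and \<psi> F E
begin

definition tot :: "('a \<Rightarrow> real) \<Rightarrow> real" where
  "tot z = (\<Sum>i=1..k. en (\<lambda>x. z (\<psi> i x)))"

lemma tot_cong:
  assumes "\<And>y. y \<in> V1 \<Longrightarrow> z y = z' y"
  shows "tot z = tot z'"
  unfolding tot_def using assms psi_in_V1 by (intro sum.cong en_cong refl) auto

lemma tot_nonneg: "0 \<le> tot z"
  unfolding tot_def by (intro sum_nonneg en_nonneg)

lemma tot_convex:
  assumes "0 \<le> t" "t \<le> 1"
  shows "tot (\<lambda>x. (1 - t) * f x + t * g x) \<le> (1 - t) * tot f + t * tot g"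
  unfolding tot_def sum_distrib_left sum.distrib[symmetric]
  by (intro sum_mono en_convex assms)

lemma tot_shift: "tot (\<lambda>x. f x + c) = tot f"
  unfolding tot_def by (simp add: en_shift)

lemma tot_uminus: "tot (\<lambda>x. - f x) = tot f"
  unfolding tot_def by (simp add: en_uminus)

lemma tot_trunc: "b \<le> a \<Longrightarrow> tot (\<lambda>x. max (min (f x) a) b) \<le> tot f"
  unfolding tot_def by (intro sum_mono en_trunc)

lemma continuous_on_tot: "continuous_on UNIV tot"
proof -
  have "continuous_on UNIV (\<lambda>z :: 'a \<Rightarrow> real. en (\<lambda>x. z (\<psi> i x)))" for i
  proof -
    have "continuous_on UNIV (\<lambda>z :: 'a \<Rightarrow> real. (\<lambda>x. z (\<psi> i x)))"
      by (intro continuous_on_coordinatewise_then_product) simp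
    then show ?thesis
      using continuous_on_compose2[OF continuous_on_en] by blast
  qed
  then have "continuous_on UNIV (\<lambda>z. \<Sum>i=1..k. en (\<lambda>x. z (\<psi> i x)))"
    by (intro continuous_on_sum)
  then show ?thesis unfolding tot_def[abs_def] .
qed

text \<open>Zero total energy makes the function constant on every cell, and neighbouring cells share a
  vertex.\<close>

lemma tot_zero_iff: "tot z = 0 \<longleftrightarrow> const_on V1 z"
proof
  assume "tot z = 0"
  then have "\<forall>i\<in>{1..k}. en (\<lambda>x. z (\<psi> i x)) = 0"
    unfolding tot_def using en_nonneg by (subst (asm) sum_nonneg_eq_0_iff) auto
  then have "\<forall>i\<in>{1..k}. \<exists>c. \<forall>x\<in>V0. z (\<psi> i x) = c"
    by (simp add: en_zero_iff const_on_def)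
  then obtain c where c: "\<And>i x. i \<in> {1..k} \<Longrightarrow> x \<in> V0 \<Longrightarrow> z (\<psi> i x) = c i" by metis
  have c1: "c i = c 1" if i: "i \<in> {1..k}" for i
  proof -
    have "1 \<in> {1..k}" using N_ge_2 N_le_k by simp
    from chain[OF this i] obtain h :: nat and a where a: "a 0 = 1" "a h = i" "\<forall>s\<le>h. a s \<in> {1..k}"
      "\<forall>s\<in>{1..h}. \<psi> (a (s - 1)) ` V0 \<inter> \<psi> (a s) ` V0 \<noteq> {}" by blast
    have "c (a s) = c 1" if "s \<le> h" for s
      using that
    proof (induction s)
      case 0 then show ?case using a by simp
    next
      case (Suc s)
      have "Suc s \<in> {1..h}" using Suc.prems by simp
      then have "\<psi> (a s) ` V0 \<inter> \<psi> (a (Suc s)) ` V0 \<noteq> {}" using a(4) by fastforce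
      then obtain x y where "x \<in> V0" "y \<in> V0" "\<psi> (a s) x = \<psi> (a (Suc s)) y" by blast
      then have "c (a s) = c (a (Suc s))" using c a(3) Suc.prems by (metis Suc_leD)
      then show ?case using Suc by simp
    qed
    then show ?thesis using a(2) by blast
  qed
  have "z y = c 1" if y: "y \<in> V1" for y
  proof -
    obtain i x where "i \<in> {1..k}" "x \<in> V0" "y = \<psi> i x" using y unfolding V1_eq by auto
    then show ?thesis using c c1 by metis
  qed
  then show "const_on V1 z" unfolding const_on_def by blast
next
  assume "const_on V1 z"
  then obtain c where "\<And>y. y \<in> V1 \<Longrightarrow> z y = c" unfolding const_on_def by blast
  then have "en (\<lambda>x. z (\<psi> i x)) = 0" if "i \<in> {1..k}" for i
    unfolding en_zero_iff const_on_def using psi_in_V1[OF that] by blast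
  then show "tot z = 0" unfolding tot_def by simp
qed

lemma S_energy_eq: "S_energy k \<psi> V0 \<theta> E v = tot (\<lambda>y. \<theta> * v y)"
  by (simp add: S_energy_def tot_def en_def restrict_def)

text \<open>The bounds are part of the notion: with (Q4) in its weak form only, a minimizer might leave the
  range of its boundary values.\<close>

definition min_ext :: "('a \<Rightarrow> real) \<Rightarrow> ('a \<Rightarrow> real) \<Rightarrow> bool" where
  "min_ext w z \<longleftrightarrow> (\<forall>x\<in>V0. z x = w x) \<and>
     (\<forall>y\<in>V1. Min (w ` V0) \<le> z y \<and> z y \<le> Max (w ` V0)) \<and>
     (\<forall>z'. (\<forall>x\<in>V0. z' x = w x) \<longrightarrow> tot z \<le> tot z')"

lemma min_extD:
  assumes "min_ext w z"
  shows "x \<in> V0 \<Longrightarrow> z x = w x" "y \<in> V1 \<Longrightarrow> Min (w ` V0) \<le> z y" "y \<in> V1 \<Longrightarrow> z y \<le> Max (w ` V0)"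
    "(\<And>x. x \<in> V0 \<Longrightarrow> z' x = w x) \<Longrightarrow> tot z \<le> tot z'"
  using assms unfolding min_ext_def by auto

lemma min_ext_osc_cell_le:
  assumes z: "min_ext w z" and i: "i \<in> {1..k}"
  shows "osc V0 (\<lambda>x. z (\<psi> i x)) \<le> osc V0 w"
proof (rule osc_leI)
  fix x y assume "x \<in> V0" "y \<in> V0"
  then show "z (\<psi> i x) - z (\<psi> i y) \<le> osc V0 w"
    using min_extD(3)[OF z psi_in_V1[OF i]] min_extD(2)[OF z psi_in_V1[OF i]]
    unfolding osc_def by (meson diff_mono)
qed

text \<open>Truncation at the extreme boundary values does not raise the energy, so the minimum over the
  compact box of functions between these values is a minimum over all extensions.\<close>

lemma min_ext_exists:
  obtains z where "min_ext w z"
proof -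
  let ?m = "Min (w ` V0)" and ?M = "Max (w ` V0)"
  have mM: "?m \<le> ?M" using Min_le_at[of _ w] le_Max_at[of _ w] neV by force
  define S where "S y = (if y \<in> V0 then {w y} else {?m..?M})" for y
  define K where "K = {f. \<forall>x. f x \<in> S x}"
  have "compact K" unfolding K_def by (rule compact_box) (simp add: S_def)
  moreover have "(\<lambda>y. if y \<in> V0 then w y else ?m) \<in> K"
    unfolding K_def S_def using mM by simp
  then have "K \<noteq> {}" by blast
  moreover have "continuous_on K tot"
    using continuous_on_subset[OF continuous_on_tot] by simp
  ultimately obtain z where z: "z \<in> K" "\<And>z'. z' \<in> K \<Longrightarrow> tot z \<le> tot z'"
    using continuous_attains_inf[of K tot] by metis
  have "tot z \<le> tot z'" if z': "\<forall>x\<in>V0. z' x = w x" for z'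
  proof -
    have "(\<lambda>x. max (min (z' x) ?M) ?m) \<in> K"
      unfolding K_def S_def using z' mM Min_le_at[of _ w] le_Max_at[of _ w]
      by (auto simp: min_absorb1 max_absorb1)
    then have "tot z \<le> tot (\<lambda>x. max (min (z' x) ?M) ?m)" by (rule z(2))
    also have "\<dots> \<le> tot z'" by (rule tot_trunc[OF mM])
    finally show ?thesis .
  qed
  moreover have "z x = w x" if "x \<in> V0" for x
  proof -
    have "z x \<in> S x" using z(1) unfolding K_def by blast
    then show ?thesis using that by (simp add: S_def)
  qed
  moreover have "?m \<le> z y \<and> z y \<le> ?M" for y
  proof -
    have "z y \<in> S y" using z(1) unfolding K_def by blast
    then show ?thesis using Min_le_at[of y w] le_Max_at[of y w] by (auto simp: S_def split: if_splits)
  qed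
  ultimately have "min_ext w z" unfolding min_ext_def by blast
  then show thesis by (rule that)
qed

definition Lam :: "('a \<Rightarrow> real) \<Rightarrow> real" where
  "Lam w = Renorm k \<psi> V0 1 E w"

lemma Renorm_eq_tot:
  assumes "\<theta> \<noteq> 0" and z: "min_ext (\<lambda>x. \<theta> * u x) z"
  shows "Renorm k \<psi> V0 \<theta> E u = tot z"
  unfolding Renorm_def
proof (rule cInf_eq_minimum)
  define v where "v = restrict (\<lambda>y. z y / \<theta>) V1"
  have "v \<in> ext_L k \<psi> V0 u"
    unfolding ext_L_def v_def using V0_subset_V1 min_extD(1)[OF z] \<open>\<theta> \<noteq> 0\<close> by auto
  moreover have "S_energy k \<psi> V0 \<theta> E v = tot z"
    unfolding S_energy_eq using \<open>\<theta> \<noteq> 0\<close> by (intro tot_cong) (simp add: v_def)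
  ultimately show "tot z \<in> S_energy k \<psi> V0 \<theta> E ` ext_L k \<psi> V0 u"
    by (metis imageI)
next
  fix a assume "a \<in> S_energy k \<psi> V0 \<theta> E ` ext_L k \<psi> V0 u"
  then show "tot z \<le> a"
    unfolding ext_L_def S_energy_eq by (auto intro!: min_extD(4)[OF z])
qed

lemma Lam_eq: "min_ext w z \<Longrightarrow> Lam w = tot z"
  unfolding Lam_def using Renorm_eq_tot[of 1 w z] by simp

lemma Renorm_eq_Lam: "\<theta> \<noteq> 0 \<Longrightarrow> Renorm k \<psi> V0 \<theta> E u = Lam (\<lambda>x. \<theta> * u x)"
  using min_ext_exists[of "\<lambda>x. \<theta> * u x"] Renorm_eq_tot Lam_eq by metis

lemma Lam_le: "(\<And>x. x \<in> V0 \<Longrightarrow> z x = w x) \<Longrightarrow> Lam w \<le> tot z"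
  using min_ext_exists[of w] Lam_eq min_extD(4) by metis

lemma Lam_nonneg: "0 \<le> Lam w"
  using min_ext_exists[of w] Lam_eq tot_nonneg by metis

lemma Lam_convex:
  assumes "0 \<le> t" "t \<le> 1"
  shows "Lam (\<lambda>x. (1 - t) * f x + t * g x) \<le> (1 - t) * Lam f + t * Lam g"
proof -
  obtain zf where zf: "min_ext f zf" by (rule min_ext_exists)
  obtain zg where zg: "min_ext g zg" by (rule min_ext_exists)
  have "Lam (\<lambda>x. (1 - t) * f x + t * g x) \<le> tot (\<lambda>x. (1 - t) * zf x + t * zg x)"
    using min_extD(1)[OF zf] min_extD(1)[OF zg] by (intro Lam_le) simp
  also have "\<dots> \<le> (1 - t) * tot zf + t * tot zg" by (rule tot_convex[OF assms])
  finally show ?thesis using Lam_eq[OF zf] Lam_eq[OF zg] by simp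
qed

lemma Lam_zero_iff: "Lam w = 0 \<longleftrightarrow> const_on V0 w"
proof -
  obtain z where z: "min_ext w z" by (rule min_ext_exists)
  have "const_on V1 z \<longleftrightarrow> const_on V0 w"
  proof
    assume "const_on V1 z"
    then obtain c where "\<forall>y\<in>V1. z y = c" unfolding const_on_def by blast
    then have "\<forall>x\<in>V0. w x = c" using V0_subset_V1 min_extD(1)[OF z] by (metis subsetD)
    then show "const_on V0 w" unfolding const_on_def by blast
  next
    assume "const_on V0 w"
    then obtain c where c: "\<forall>x\<in>V0. w x = c" unfolding const_on_def by blast
    then have "w ` V0 = {c}" using neV by force
    then have "\<forall>y\<in>V1. z y = c" using min_extD(2,3)[OF z] by fastforce
    then show "const_on V1 z" unfolding const_on_def by blast
  qed
  then show ?thesis using tot_zero_iff[of z] Lam_eq[OF z] by simp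
qed

lemma Lam_pos_iff: "0 < Lam w \<longleftrightarrow> \<not> const_on V0 w"
  using Lam_zero_iff[of w] Lam_nonneg[of w] by linarith

lemma Lam_scale_le:
  assumes "0 \<le> t" "t \<le> 1"
  shows "Lam (\<lambda>x. t * f x) \<le> t * Lam f"
proof -
  have "Lam (\<lambda>_. 0) = 0" by (simp add: Lam_zero_iff const_on_def)
  then show ?thesis using Lam_convex[OF assms, of "\<lambda>_. 0" f] by simp
qed

lemma Lam_ray_strict_mono:
  assumes "\<not> const_on V0 u" "0 \<le> s" "s < t"
  shows "Lam (\<lambda>x. s * u x) < Lam (\<lambda>x. t * u x)"
proof -
  have t: "0 < t" using assms by simp
  have "\<not> const_on V0 (\<lambda>x. t * u x)"
    using assms(1) t osc_scale[of t u] by (simp add: const_on_iff_osc)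
  then have pos: "0 < Lam (\<lambda>x. t * u x)" by (simp add: Lam_pos_iff)
  have "Lam (\<lambda>x. s / t * (t * u x)) \<le> s / t * Lam (\<lambda>x. t * u x)"
    using assms t by (intro Lam_scale_le) auto
  moreover have "s / t * Lam (\<lambda>x. t * u x) < 1 * Lam (\<lambda>x. t * u x)"
    using assms t pos by (intro mult_strict_right_mono) auto
  moreover have "(\<lambda>x. s / t * (t * u x)) = (\<lambda>x. s * u x)" using t by auto
  ultimately show ?thesis by simp
qed

text \<open>Along the ray of a nonconstant function the renormalized energy is convex and vanishes at 0 only.
  So it is continuous, increasing and unbounded.\<close>

lemma Lam_ray_unique:
  assumes u: "\<not> const_on V0 u" and c: "0 < c"
  shows "\<exists>!\<theta>. 0 < \<theta> \<and> Lam (\<lambda>x. \<theta> * u x) = c"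
proof -
  let ?f = "\<lambda>\<theta>. Lam (\<lambda>x. \<theta> * u x)"
  have "convex_on UNIV ?f"
  proof (rule convex_onI)
    fix t a b :: real assume "0 < t" "t < 1"
    then have "Lam (\<lambda>x. (1 - t) * (a * u x) + t * (b * u x)) \<le> (1 - t) * ?f a + t * ?f b"
      by (intro Lam_convex) auto
    then show "?f ((1 - t) *\<^sub>R a + t *\<^sub>R b) \<le> (1 - t) * ?f a + t * ?f b"
      by (simp add: algebra_simps)
  qed simp
  then have cont: "continuous_on UNIV ?f" by (intro convex_on_continuous) auto
  have f0: "?f 0 = 0" by (simp add: Lam_zero_iff const_on_def)
  have f1: "0 < ?f 1" using u by (simp add: Lam_pos_iff)
  define T where "T = max 1 (c / ?f 1)"
  have "?f 1 \<le> ?f T / T"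
    using Lam_scale_le[of "1 / T" "\<lambda>x. T * u x"] unfolding T_def by (simp add: max_def)
  moreover have "c \<le> T * ?f 1" unfolding T_def using f1 by (simp add: field_simps max_def)
  moreover have "T \<ge> 1" unfolding T_def by simp
  ultimately have "c \<le> ?f T" by (simp add: field_simps)
  then obtain \<theta> where \<theta>: "0 \<le> \<theta>" "?f \<theta> = c"
    using IVT'[of ?f 0 c T] f0 c \<open>T \<ge> 1\<close> continuous_on_subset[OF cont] by auto
  moreover have "\<theta> \<noteq> 0" using \<theta> f0 c by auto
  ultimately show ?thesis
    using Lam_ray_strict_mono[OF u] by (metis linorder_neqE_linordered_idom order_less_irrefl order_le_less)
qed

end


section \<open>Harmonic extensions contract the oscillation on cells\<close>

text \<open>(Q5) acts as a smoothness condition. On two points it excludes the kink of the absolute value,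
  for which a minimizer may be constant on some cells and jump across a single one.\<close>

locale smooth_energy = fractal_energy +
  assumes Q4: "Q4 (V_zero N P) E" and Q5: "Q5 (V_zero N P) E"
begin

lemma en_trunc_strict:
  assumes "b \<le> a" "\<not> const_on V0 f" "x \<in> V0" "max (min (f x) a) b \<noteq> f x"
  shows "en (\<lambda>x. max (min (f x) a) b) < en f"
proof -
  have eq: "trunc_fun V0 a b (restrict f V0) = restrict (\<lambda>x. max (min (f x) a) b) V0"
    unfolding trunc_fun_def by (auto simp: restrict_def)
  have "\<not> const_on V0 (restrict f V0)"
    using assms(2) unfolding const_on_def by auto
  moreover have "trunc_fun V0 a b (restrict f V0) \<noteq> restrict f V0"
    unfolding eq using assms(3,4) by (metis restrict_apply')
  ultimately have "E (trunc_fun V0 a b (restrict f V0)) < E (restrict f V0)"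
    using Q4 assms(1) unfolding Q4_def by simp
  then show ?thesis unfolding eq en_def .
qed

lemma en_Q5:
  assumes "\<And>x. x \<in> V0 \<Longrightarrow> f x = Min (f ` V0) \<Longrightarrow> 0 \<le> h x"
    and "\<And>x. x \<in> V0 \<Longrightarrow> f x > Min (f ` V0) \<Longrightarrow> h x = 0"
  obtains D where "((\<lambda>t. en (\<lambda>x. f x + t * h x)) has_real_derivative D) (at_right 0)" "D \<le> 0"
proof -
  let ?f = "restrict f V0" and ?h = "restrict h V0"
  have img: "?f ` V0 = f ` V0" by auto
  have "\<exists>D. ((\<lambda>t. E (\<lambda>x\<in>V0. ?f x + t * ?h x)) has_real_derivative D) (at_right 0) \<and> D \<le> 0"
    using Q5[unfolded Q5_def, rule_format, of ?f ?h] assms unfolding img by simp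
  moreover have "(\<lambda>x\<in>V0. ?f x + t * ?h x) = restrict (\<lambda>x. f x + t * h x) V0" for t
    by (rule restrict_ext) simp
  ultimately show thesis using that unfolding en_def by auto
qed

lemma en_Q5_eventually:
  assumes "\<And>x. x \<in> V0 \<Longrightarrow> f x = Min (f ` V0) \<Longrightarrow> 0 \<le> h x"
    and "\<And>x. x \<in> V0 \<Longrightarrow> f x > Min (f ` V0) \<Longrightarrow> h x = 0"
    and "0 < e"
  shows "\<forall>\<^sub>F t in at_right 0. en (\<lambda>x. f x + t * h x) \<le> en f + e * t"
proof -
  obtain D where D: "((\<lambda>t. en (\<lambda>x. f x + t * h x)) has_real_derivative D) (at_right 0)" "D \<le> 0"
    using en_Q5[of f h, OF assms(1,2)] by blast
  then have "((\<lambda>t. (en (\<lambda>x. f x + t * h x) - en f) / t) \<longlongrightarrow> D) (at_right 0)"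
    by (simp add: has_field_derivative_iff)
  then have "\<forall>\<^sub>F t in at_right 0. (en (\<lambda>x. f x + t * h x) - en f) / t < e"
    using D(2) assms(3) by (intro order_tendstoD(2)[of _ D]) auto
  then show ?thesis
    using eventually_at_right_less[of 0]
    by eventually_elim (simp add: field_simps)
qed

text \<open>Let a minimizer attain its minimum \<open>m\<close> in a cell where it is not constant, at interior
  vertices only. Raising all interior vertices of value \<open>m\<close> by \<open>t\<close> truncates the function from
  below in that cell, so strict (Q4) and convexity make the energy there drop at a linear rate.
  In every other cell (Q5) bounds the growth by \<open>o(t)\<close>. So the total energy drops, against
  minimality.\<close>

lemma no_interior_minimum_in_nonconstant_cell:
  assumes min: "\<And>z'. (\<And>x. x \<in> V0 \<Longrightarrow> z' x = z x) \<Longrightarrow> tot z \<le> tot z'"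
    and lb: "\<And>y. y \<in> V1 \<Longrightarrow> m \<le> z y"
    and i: "i \<in> {1..k}" and y0: "y0 \<in> V0" "z (\<psi> i y0) = m"
    and nc: "\<not> const_on V0 (\<lambda>x. z (\<psi> i x))"
    and corner: "i \<in> {1..N} \<Longrightarrow> z (P i) \<noteq> m"
  shows False
proof -
  \<comment> \<open>In the cell \<open>i\<close> the corner hypothesis makes all vertices of value \<open>m\<close> interior.\<close>
  define h where "h y = (if y \<notin> V0 \<and> z y = m then 1 else 0 :: real)" for y
  define f where "f x = z (\<psi> i x)" for x
  have fm: "m \<le> f x" if "x \<in> V0" for x
    unfolding f_def by (rule lb[OF psi_in_V1[OF i that]])
  have hi: "h (\<psi> i x) = (if f x = m then 1 else 0)" if "x \<in> V0" for x
    using psi_corner[OF i that] corner unfolding h_def f_def by auto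
  \<comment> \<open>Up to \<open>t0\<close> the raised vertices do not pass any other value in the cell; the value 1 is arbitrary.\<close>
  define t0 where "t0 = Min ((\<lambda>x. if f x = m then 1 else f x - m) ` V0)"
  have t0: "0 < t0"
  proof -
    obtain x where "x \<in> V0" "(if f x = m then 1 else f x - m) = t0"
      unfolding t0_def by (rule Min_attained)
    then show ?thesis using fm[of x] by (auto split: if_splits)
  qed
  have gap: "f x = m \<or> m + t0 \<le> f x" if "x \<in> V0" for x
    using Min_le_at[OF that, of "\<lambda>x. if f x = m then 1 else f x - m"]
    unfolding t0_def[symmetric] by (auto split: if_splits)
  \<comment> \<open>An upper level at the maximum makes the truncation act from below only.\<close>
  define a where "a = Max (f ` V0)"
  have a: "m + t0 \<le> a"
  proof -
    obtain x where "x \<in> V0" "f x \<noteq> m" using nc unfolding const_on_def f_def by blast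
    then show ?thesis using gap[of x] le_Max_at[of x f] unfolding a_def by force
  qed
  have raise: "f x + t0 * h (\<psi> i x) = max (min (f x) a) (m + t0)" if "x \<in> V0" for x
    using gap[OF that] a le_Max_at[OF that, of f] t0 unfolding hi[OF that] a_def[symmetric]
    by auto
  have "en (\<lambda>x. f x + t0 * h (\<psi> i x)) = en (\<lambda>x. max (min (f x) a) (m + t0))"
    by (rule en_cong[OF raise])
  also have "\<dots> < en f"
    using nc raise[OF y0(1)] hi[OF y0(1)] y0(2) t0
    by (intro en_trunc_strict[OF a _ y0(1)]) (auto simp: f_def)
  finally have drop: "en (\<lambda>x. f x + t0 * h (\<psi> i x)) < en f" .
  define c where "c = (en f - en (\<lambda>x. f x + t0 * h (\<psi> i x))) / t0"
  have c: "0 < c" unfolding c_def using drop t0 by simp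
  have linear: "en (\<lambda>x. f x + t * h (\<psi> i x)) \<le> en f - c * t" if "0 < t" "t < t0" for t
  proof -
    have "en (\<lambda>x. (1 - t / t0) * f x + t / t0 * (f x + t0 * h (\<psi> i x)))
        \<le> (1 - t / t0) * en f + t / t0 * en (\<lambda>x. f x + t0 * h (\<psi> i x))"
      using that by (intro en_convex) auto
    moreover have "(\<lambda>x. (1 - t / t0) * f x + t / t0 * (f x + t0 * h (\<psi> i x)))
        = (\<lambda>x. f x + t * h (\<psi> i x))"
      using t0 by (auto simp: field_simps)
    moreover have "(1 - t / t0) * en f + t / t0 * en (\<lambda>x. f x + t0 * h (\<psi> i x)) = en f - c * t"
      unfolding c_def using t0 by (simp add: field_simps)
    ultimately show ?thesis by simp
  qed
  \<comment> \<open>The \<open>k\<close> error terms together take only half of the gain \<open>c t\<close>.\<close>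
  define e where "e = c / (2 * k)"
  have k: "0 < k" using i by auto
  have e: "0 < e" unfolding e_def using c k by simp
  have "\<forall>\<^sub>F t in at_right 0. \<forall>j\<in>{1..k}.
      en (\<lambda>x. z (\<psi> j x) + t * h (\<psi> j x)) \<le> en (\<lambda>x. z (\<psi> j x)) + e * t"
  proof (intro eventually_ball_finite ballI en_Q5_eventually e)
    fix j x assume j: "j \<in> {1..k}" and x: "x \<in> V0"
    show "0 \<le> h (\<psi> j x)" by (simp add: h_def)
    assume *: "Min ((\<lambda>x. z (\<psi> j x)) ` V0) < z (\<psi> j x)"
    obtain y where "y \<in> V0" "z (\<psi> j y) = Min ((\<lambda>x. z (\<psi> j x)) ` V0)" by (rule Min_attained)
    then have "m < z (\<psi> j x)" using * lb[OF psi_in_V1[OF j], of y] by simp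
    then show "h (\<psi> j x) = 0" by (simp add: h_def)
  qed simp
  then have "\<forall>\<^sub>F t in at_right 0. 0 < t \<and> t < t0 \<and> (\<forall>j\<in>{1..k}.
      en (\<lambda>x. z (\<psi> j x) + t * h (\<psi> j x)) \<le> en (\<lambda>x. z (\<psi> j x)) + e * t)"
    using eventually_at_right_less[of 0] eventually_at_right_real[OF t0] by eventually_elim auto
  then obtain t where t: "0 < t" "t < t0" "\<And>j. j \<in> {1..k} \<Longrightarrow>
      en (\<lambda>x. z (\<psi> j x) + t * h (\<psi> j x)) \<le> en (\<lambda>x. z (\<psi> j x)) + e * t"
    using eventually_happens'[OF trivial_limit_at_right_real] by blast
  have "tot (\<lambda>y. z y + t * h y)
      \<le> (\<Sum>j=1..k. en (\<lambda>x. z (\<psi> j x)) + e * t + (if j = i then - c * t else 0))"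
    unfolding tot_def
  proof (rule sum_mono)
    fix j assume j: "j \<in> {1..k}"
    have "0 \<le> e * t" using e t by simp
    then show "en (\<lambda>x. z (\<psi> j x) + t * h (\<psi> j x))
        \<le> en (\<lambda>x. z (\<psi> j x)) + e * t + (if j = i then - c * t else 0)"
      using t(3)[OF j] linear[OF t(1,2)] unfolding f_def by auto
  qed
  also have "\<dots> = tot z + k * (e * t) - c * t"
    unfolding tot_def sum.distrib using i by (simp add: sum.delta)
  also have "k * (e * t) = c * t / 2" unfolding e_def using k by simp
  also have "tot z + c * t / 2 - c * t < tot z" using c t(1) by simp
  finally have "tot (\<lambda>y. z y + t * h y) < tot z" .
  moreover have "tot z \<le> tot (\<lambda>y. z y + t * h y)" by (rule min) (simp add: h_def)
  ultimately show False by simp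
qed

text \<open>A cell contains at most one vertex of \<open>V0\<close>. If a cell saw both extreme values, then one of
  them would be taken at interior vertices only; up to the sign of the function, it is the
  minimum.\<close>

lemma min_ext_osc_cell_less:
  assumes z: "min_ext w z" and w: "\<not> const_on V0 w" and i: "i \<in> {1..k}"
  shows "osc V0 (\<lambda>x. z (\<psi> i x)) < osc V0 w"
proof (rule ccontr)
  assume "\<not> ?thesis"
  then have *: "osc V0 w \<le> osc V0 (\<lambda>x. z (\<psi> i x))" by simp
  define m M where "m = Min (w ` V0)" and "M = Max (w ` V0)"
  have oscw: "osc V0 w = M - m" unfolding osc_def m_def M_def ..
  have pos: "0 < osc V0 w" using w osc_pos_iff by simp
  have bds: "m \<le> z y" "z y \<le> M" if "y \<in> V1" for y
    using min_extD(2,3)[OF z that] unfolding m_def M_def by auto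
  obtain x y where xy: "x \<in> V0" "y \<in> V0" "z (\<psi> i x) - z (\<psi> i y) = osc V0 (\<lambda>x. z (\<psi> i x))"
    by (rule osc_attained)
  have zx: "z (\<psi> i x) = M" and zy: "z (\<psi> i y) = m"
    using * xy(3) oscw bds[OF psi_in_V1[OF i xy(1)]] bds[OF psi_in_V1[OF i xy(2)]] by linarith+
  have nc: "\<not> const_on V0 (\<lambda>x. z (\<psi> i x))" using * pos osc_pos_iff by (metis order_less_le_trans)
  have min: "tot z \<le> tot z'" if "\<And>x. x \<in> V0 \<Longrightarrow> z' x = z x" for z'
    using that min_extD(1)[OF z] by (intro min_extD(4)[OF z]) simp
  show False
  proof (cases "i \<in> {1..N} \<and> z (P i) = m")
    case False
    then show False
      using no_interior_minimum_in_nonconstant_cell[of z m i y, OF min bds(1) i xy(2) zy nc] by blast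
  next
    case True
    have "tot (\<lambda>y. - z y) \<le> tot z'" if "\<And>x. x \<in> V0 \<Longrightarrow> z' x = - z x" for z'
      using min[of "\<lambda>y. - z' y"] that tot_uminus[of z] tot_uminus[of z'] by simp
    moreover have "\<not> const_on V0 (\<lambda>x. - z (\<psi> i x))"
      using nc unfolding const_on_def by (metis minus_equation_iff)
    ultimately show False
      using no_interior_minimum_in_nonconstant_cell[of "\<lambda>y. - z y" "- M" i x] bds i xy zx True
        pos oscw by auto
  qed
qed

text \<open>Being a minimizer is a closed condition, so the minimizers with boundary minimum 0 and boundary
  oscillation in \<open>{a..b}\<close> form a compact set, on which the strict inequality is uniform.\<close>

lemma uniform_contraction:
  assumes a: "0 < a"
  obtains d where "0 < d" "d \<le> 1"
    "\<And>w z i. min_ext w z \<Longrightarrow> a \<le> osc V0 w \<Longrightarrow> osc V0 w \<le> b \<Longrightarrow> i \<in> {1..k} \<Longrightarrow>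
       osc V0 (\<lambda>x. z (\<psi> i x)) \<le> (1 - d) * osc V0 w"
proof -
  define S where "S y = (if y \<in> V1 then {0..b} else {0::real})" for y
  define H where "H = {h :: 'a \<Rightarrow> real. \<forall>x\<in>V0. h x = 0}"
  define K1 where "K1 = {f. a \<le> osc V0 f}"
  \<comment> \<open>\<open>K2\<close> expresses minimality among all functions with the same boundary values.\<close>
  define K2 where "K2 = (\<Inter>h\<in>H. {f. tot f \<le> tot (\<lambda>x. f x + h x)})"
  define K3 where "K3 = (\<Inter>y\<in>V1. {f :: 'a \<Rightarrow> real. Min (f ` V0) \<le> f y} \<inter> {f. f y \<le> Max (f ` V0)})"
  define K where "K = {f. \<forall>y. f y \<in> S y} \<inter> (K1 \<inter> K2 \<inter> K3)"
  have "closed K1" unfolding K1_def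
    by (intro closed_Collect_le continuous_on_osc finV neV) auto
  moreover have "closed K2" unfolding K2_def
  proof (intro closed_INT ballI closed_Collect_le)
    fix h :: "'a \<Rightarrow> real"
    have "continuous_on UNIV (\<lambda>f :: 'a \<Rightarrow> real. (\<lambda>x. f x + h x))"
      by (intro continuous_on_coordinatewise_then_product continuous_intros) simp
    then show "continuous_on UNIV (\<lambda>f. tot (\<lambda>x. f x + h x))"
      using continuous_on_compose2[OF continuous_on_tot] by blast
  qed (rule continuous_on_tot)
  moreover have "closed K3" unfolding K3_def
    by (intro closed_INT ballI closed_Int closed_Collect_le continuous_on_Min_image
        continuous_on_Max_image finV neV) auto
  moreover have "compact {f. \<forall>y. f y \<in> S y}" by (rule compact_box) (simp add: S_def)
  ultimately have K: "compact K" unfolding K_def by (intro compact_Int_closed closed_Int)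
  define R where "R f = Max ((\<lambda>i. osc V0 (\<lambda>x. f (\<psi> i x)) / osc V0 f) ` {1..k})" for f
  have k: "{1..k} \<noteq> {}" using N_ge_2 N_le_k by simp
  have KR: "continuous_on K R" unfolding R_def
  proof (intro continuous_on_Max_image continuous_on_divide)
    show "continuous_on K (\<lambda>f. osc V0 (\<lambda>x. f (\<psi> i x)))" for i
      by (intro continuous_on_osc[OF finV neV] continuous_on_subset[OF continuous_on_product_coordinates]) auto
    show "continuous_on K (osc V0)"
      by (intro continuous_on_osc[OF finV neV] continuous_on_subset[OF continuous_on_product_coordinates]) auto
    show "\<forall>f\<in>K. osc V0 f \<noteq> 0" unfolding K_def K1_def using a by auto
  qed (use k in auto)
  have less1: "R f < 1" if "f \<in> K" for f
  proof -
    have f: "f \<in> K1" "f \<in> K2" "f \<in> K3" using that unfolding K_def by auto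
    have "tot f \<le> tot z'" if "\<forall>x\<in>V0. z' x = f x" for z'
    proof -
      have "(\<lambda>x. z' x - f x) \<in> H" using that unfolding H_def by simp
      then show ?thesis using f(2) unfolding K2_def by fastforce
    qed
    then have "min_ext f f" using f(3) unfolding min_ext_def K3_def by blast
    moreover have "\<not> const_on V0 f" using f(1) a osc_pos_iff[of f] unfolding K1_def by simp
    ultimately have "osc V0 (\<lambda>x. f (\<psi> i x)) / osc V0 f < 1" if "i \<in> {1..k}" for i
      using min_ext_osc_cell_less[of f f i] that osc_nonneg[of "\<lambda>x. f (\<psi> i x)"] by simp
    then show ?thesis unfolding R_def using k by (subst Max_less_iff) auto
  qed
  obtain r where r: "r < 1" "0 \<le> r" "\<And>f. f \<in> K \<Longrightarrow> R f \<le> r"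
  proof (cases "K = {}")
    case True then show thesis using that[of 0] by simp
  next
    case False
    obtain f0 where f0: "f0 \<in> K" "\<And>f. f \<in> K \<Longrightarrow> R f \<le> R f0"
      using continuous_attains_sup[OF K False KR] by metis
    then show thesis using that[of "max 0 (R f0)"] less1[OF f0(1)] by (simp add: max.coboundedI2)
  qed
  have "osc V0 (\<lambda>x. z (\<psi> i x)) \<le> (1 - (1 - r)) * osc V0 w"
    if z: "min_ext w z" and w: "a \<le> osc V0 w" "osc V0 w \<le> b" and i: "i \<in> {1..k}" for w z i
  proof -
    define m where "m = Min (w ` V0)"
    \<comment> \<open>Normalize \<open>z\<close> to have boundary minimum 0, and forget its values off the first level.\<close>
    define f where "f y = (if y \<in> V1 then z y + (- m) else 0)" for y
    have fV0: "f x = 1 * w x + (- m)" if "x \<in> V0" for x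
      unfolding f_def using that V0_subset_V1 min_extD(1)[OF z] by auto
    have oscf: "osc V0 f = osc V0 w"
      using osc_cong[of V0 f, OF fV0] osc_affine[of 1 w "- m"] by simp
    have bds: "0 \<le> f y" "f y \<le> osc V0 w" if "y \<in> V1" for y
      using that min_extD(2,3)[OF z that] unfolding f_def m_def osc_def by auto
    have "f y \<in> S y" for y
      using bds[of y] w(2) unfolding S_def by (auto simp: f_def)
    moreover have "f \<in> K1" unfolding K1_def using oscf w by simp
    moreover have "f \<in> K2"
    proof -
      have "tot f \<le> tot (\<lambda>x. f x + h x)" if "h \<in> H" for h
      proof -
        have "tot f = tot (\<lambda>y. z y + (- m))" by (rule tot_cong) (simp add: f_def)
        also have "\<dots> = tot z" by (rule tot_shift)
        also have "\<dots> \<le> tot (\<lambda>y. z y + h y)"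
          using that min_extD(1)[OF z] unfolding H_def by (intro min_extD(4)[OF z]) simp
        also have "\<dots> = tot (\<lambda>y. z y + h y + (- m))" by (rule tot_shift[symmetric])
        also have "\<dots> = tot (\<lambda>x. f x + h x)" by (rule tot_cong) (simp add: f_def)
        finally show ?thesis .
      qed
      then show ?thesis unfolding K2_def by blast
    qed
    moreover have "f \<in> K3"
    proof -
      obtain x1 where x1: "x1 \<in> V0" "w x1 = Min (w ` V0)" by (rule Min_attained)
      obtain x2 where x2: "x2 \<in> V0" "w x2 = Max (w ` V0)" by (rule Max_attained)
      have "f x1 = 0" "f x2 = osc V0 w"
        using fV0 x1 x2 by (auto simp: m_def osc_def)
      then have "Min (f ` V0) \<le> 0" "osc V0 w \<le> Max (f ` V0)"
        using Min_le_at[OF x1(1), of f] le_Max_at[OF x2(1), of f] by auto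
      then show ?thesis unfolding K3_def using bds by force
    qed
    ultimately have "f \<in> K" unfolding K_def by blast
    then have "R f \<le> r" by (rule r(3))
    moreover have "osc V0 (\<lambda>x. f (\<psi> i x)) / osc V0 f \<le> R f"
      unfolding R_def using i by (intro Max_ge) auto
    ultimately have "osc V0 (\<lambda>x. f (\<psi> i x)) / osc V0 f \<le> r" by linarith
    then have "osc V0 (\<lambda>x. f (\<psi> i x)) \<le> r * osc V0 f"
      using w(1) a oscf by (simp add: pos_divide_le_eq)
    moreover have "f (\<psi> i x) = 1 * z (\<psi> i x) + (- m)" if "x \<in> V0" for x
      unfolding f_def using psi_in_V1[OF i that] by simp
    then have "osc V0 (\<lambda>x. f (\<psi> i x)) = osc V0 (\<lambda>x. 1 * z (\<psi> i x) + (- m))"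
      by (rule osc_cong)
    then have "osc V0 (\<lambda>x. f (\<psi> i x)) = osc V0 (\<lambda>x. z (\<psi> i x))"
      using osc_affine[of 1 "\<lambda>x. z (\<psi> i x)" "- m"] by simp
    ultimately show ?thesis using oscf by simp
  qed
  then show thesis using that[of "1 - r"] r by simp
qed

end


section \<open>Comparison with the homogeneous eigenfunctional\<close>

text \<open>Strict (Q4) and (Q5) are hypotheses on \<open>E\<close> alone, so minimizers for \<open>E'\<close> are not known to contract
  oscillations; at small scales, homogeneity and \<open>\<rho> < 1\<close> take the place of contraction.\<close>

locale nonlinear_energy =
  smooth_energy N k P \<psi> F E + tilde: fractal_energy N k P \<psi> F E'
  for N k :: nat and P :: "nat \<Rightarrow> 'a::metric_space" and \<psi> F E E' +
  fixes p \<rho> \<sigma> :: real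
  assumes witness: "A2_witness k \<psi> (V_zero N P) E E' p \<rho>"
    and sigma: "0 < \<sigma>" "\<sigma> \<le> 1"
begin

lemma p_pos: "0 < p" and rho_pos: "0 < \<rho>"
  using witness by (auto simp: A2_witness_def)

lemma tilde_homogeneous: "tilde.en (\<lambda>x. t * f x) = \<bar>t\<bar> powr p * tilde.en f"
proof -
  have "E' (\<lambda>x\<in>V0. t * restrict f V0 x) = \<bar>t\<bar> powr p * E' (restrict f V0)"
    using witness unfolding A2_witness_def homogeneous_def by (meson restrict_extensional)
  moreover have "(\<lambda>x\<in>V0. t * restrict f V0 x) = restrict (\<lambda>x. t * f x) V0"
    by (rule restrict_ext) simp
  ultimately show ?thesis unfolding tilde.en_def by simp
qed

lemma tilde_Lam: "tilde.Lam w = \<rho> * tilde.en w"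
proof -
  have "Renorm k \<psi> V0 1 E' (restrict w V0) = \<rho> * E' (restrict w V0)"
    using witness unfolding A2_witness_def by simp
  moreover have "ext_L k \<psi> V0 (restrict w V0) = ext_L k \<psi> V0 w"
    unfolding ext_L_def by auto
  ultimately show ?thesis unfolding tilde.Lam_def tilde.en_def Renorm_def by simp
qed

text \<open>Both functionals are invariant under constants, so small oscillation suffices for the comparison
  at zero.\<close>

lemma en_close_to_tilde:
  assumes "0 < \<eta>"
  obtains \<delta> where "0 < \<delta>"
    "\<And>f. osc V0 f < \<delta> \<Longrightarrow> (1 - \<eta>) * tilde.en f \<le> en f"
    "\<And>f. osc V0 f < \<delta> \<Longrightarrow> en f \<le> (1 + \<eta>) * tilde.en f"
proof -
  have "asymp_at_zero V0 E E'" using witness unfolding A2_witness_def by simp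
  then obtain \<delta> where \<delta>: "0 < \<delta>" "\<And>u. u \<in> extensional V0 \<Longrightarrow> \<not> const_on V0 u \<Longrightarrow>
      (\<forall>x\<in>V0. \<bar>u x\<bar> < \<delta>) \<Longrightarrow> \<bar>E u / E' u - 1\<bar> < \<eta>"
    using assms unfolding asymp_at_zero_def by metis
  have "(1 - \<eta>) * tilde.en f \<le> en f \<and> en f \<le> (1 + \<eta>) * tilde.en f" if f: "osc V0 f < \<delta>" for f
  proof (cases "const_on V0 f")
    case True
    then have "en f = 0" "tilde.en f = 0" by (simp_all add: en_zero_iff tilde.en_zero_iff)
    then show ?thesis by simp
  next
    case False
    obtain y where y: "y \<in> V0" "f y = Min (f ` V0)" by (rule Min_attained)
    define u where "u = restrict (\<lambda>x. f x + (- f y)) V0"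
    have en: "E u = en f" "E' u = tilde.en f"
      using en_shift[of f "- f y"] tilde.en_shift[of f "- f y"]
      unfolding u_def en_def tilde.en_def by simp_all
    have "\<forall>x\<in>V0. \<bar>u x\<bar> < \<delta>"
      using f diff_le_osc[OF _ y(1), of _ f] Min_le_at[of _ f] unfolding u_def y(2)[symmetric]
      by (force simp: abs_if)
    moreover have "\<not> const_on V0 u"
      using False osc_affine[of 1 f "- f y"] osc_cong[of V0 u "\<lambda>x. f x + (- f y)"]
      unfolding const_on_iff_osc by (simp add: u_def)
    ultimately have "\<bar>E u / E' u - 1\<bar> < \<eta>" by (intro \<delta>(2)) (simp_all add: u_def)
    then have "\<bar>en f / tilde.en f - 1\<bar> < \<eta>" unfolding en .
    moreover have "0 < tilde.en f" using False tilde.en_pos_iff by simp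
    ultimately show ?thesis by (simp add: abs_less_iff field_simps)
  qed
  then show thesis using that \<delta>(1) by blast
qed

definition bump :: "'a \<Rightarrow> real" where
  "bump x = (if x = P 1 then 1 else 0)"

lemma one_in: "1 \<in> {1..N}" "1 \<in> {1..k}"
  using N_ge_2 N_le_k by auto

lemma bump_not_const: "\<not> const_on V0 bump"
proof -
  have "2 \<in> {1..N}" using N_ge_2 by simp
  then have "P 2 \<noteq> P 1" using P_inj one_in(1) by (metis inj_onD numeral_One numeral_eq_iff semiring_norm(85))
  then have "bump (P 1) \<noteq> bump (P 2)" by (simp add: bump_def)
  then show ?thesis using P_in_V0 one_in(1) \<open>2 \<in> {1..N}\<close> unfolding const_on_def by metis
qed

lemma bump_energy_pos: "0 < tilde.en bump"
  using bump_not_const tilde.en_pos_iff by simp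

text \<open>By (Q5) at a constant function the energy is \<open>o(t)\<close> along the ray of \<open>bump\<close>, while it
  is asymptotic to a multiple of \<open>t powr p\<close>.\<close>

lemma p_gt_1: "1 < p"
proof (rule ccontr)
  assume "\<not> 1 < p"
  define A where "A = tilde.en bump"
  have A: "0 < A" unfolding A_def by (rule bump_energy_pos)
  obtain \<delta> where \<delta>: "0 < \<delta>" "\<And>f. osc V0 f < \<delta> \<Longrightarrow> (1 - 1/2) * tilde.en f \<le> en f"
    using en_close_to_tilde[of "1/2"] by (metis half_gt_zero zero_less_one)
  have "\<forall>\<^sub>F t in at_right 0. en (\<lambda>x. 0 + t * bump x) \<le> en (\<lambda>_. 0) + A / 4 * t"
    using neV A by (intro en_Q5_eventually) (auto simp: bump_def image_constant_conv split: if_splits)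
  moreover have "en (\<lambda>_. 0) = 0" by (simp add: en_zero_iff const_on_def)
  moreover have "0 < min 1 \<delta>" using \<delta> by simp
  from eventually_at_right_real[OF this]
  have "\<forall>\<^sub>F t in at_right 0. t \<in> {0<..<min 1 \<delta>}" .
  ultimately have "\<forall>\<^sub>F t in at_right 0. en (\<lambda>x. t * bump x) \<le> A / 4 * t \<and> t \<in> {0<..<min 1 \<delta>}"
    by (simp add: eventually_conj_iff)
  then obtain t where t: "en (\<lambda>x. t * bump x) \<le> A / 4 * t" "0 < t" "t < 1" "t < \<delta>"
    using eventually_happens'[OF trivial_limit_at_right_real] by fastforce
  have "osc V0 (\<lambda>x. t * bump x) \<le> t"
    using t by (intro osc_leI) (simp add: bump_def)
  then have "(1 - 1/2) * tilde.en (\<lambda>x. t * bump x) \<le> en (\<lambda>x. t * bump x)"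
    using t by (intro \<delta>(2)) simp
  then have "1/2 * (t powr p * A) \<le> A / 4 * t"
    using t by (simp add: tilde_homogeneous A_def)
  moreover have "t powr 1 \<le> t powr p" using t \<open>\<not> 1 < p\<close> by (intro powr_mono') auto
  then have "t * A \<le> t powr p * A" using t A by simp
  ultimately have "t * A \<le> t * A / 2" by (simp add: field_simps)
  then show False using t A by (simp add: field_simps)
qed

text \<open>Extend \<open>bump\<close> by a small value \<open>t\<close> on the other vertices of the cell of \<open>P 1\<close>. This lowers the
  energy of that cell to first order in \<open>t\<close>, and costs \<open>O(t powr p)\<close> in the others.\<close>

lemma rho_lt_1: "\<rho> < 1"
proof (rule ccontr)
  assume "\<not> \<rho> < 1"
  define A where "A = tilde.en bump"
  define g where "g y = (if y \<in> \<psi> 1 ` V0 then 1 else 0 :: real)" for y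
  define C where "C = tilde.tot g"
  have A: "0 < A" unfolding A_def by (rule bump_energy_pos)
  have C: "0 \<le> C" unfolding C_def by (rule tilde.tot_nonneg)
  have P1: "P 1 \<in> V0" "\<psi> 1 (P 1) = P 1" using P_in_V0 psi_fix one_in by auto
  have bound: "t * A \<le> t powr p * C" if t: "0 < t" "t < 1" for t
  proof -
    define z where "z y = (if y = P 1 then 1 else t * g y)" for y
    have "z x = bump x" if "x \<in> V0" for x
    proof (cases "x \<in> \<psi> 1 ` V0")
      case True
      then obtain y where "y \<in> V0" "x = \<psi> 1 y" by blast
      then have "x = P 1" using psi_corner(3)[OF one_in(2)] that by blast
      then show ?thesis by (simp add: z_def bump_def)
    qed (simp add: z_def bump_def g_def)
    then have "tilde.Lam bump \<le> tilde.tot z" by (rule tilde.Lam_le)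
    also have "\<dots> \<le> (\<Sum>i=1..k. (if i = 1 then (1 - t) powr p * A else 0)
        + t powr p * tilde.en (\<lambda>x. g (\<psi> i x)))"
      unfolding tilde.tot_def
    proof (rule sum_mono)
      fix i assume i: "i \<in> {1..k}"
      show "tilde.en (\<lambda>x. z (\<psi> i x)) \<le> (if i = 1 then (1 - t) powr p * A else 0)
        + t powr p * tilde.en (\<lambda>x. g (\<psi> i x))"
      proof (cases "i = 1")
        case True
        have "z (\<psi> 1 x) = (1 - t) * bump x + t" if "x \<in> V0" for x
        proof (cases "x = P 1")
          case False
          then have "\<psi> 1 x \<noteq> P 1" using psi_corner(2)[OF one_in(2) that] P1(1) by metis
          then show ?thesis using False that by (simp add: z_def g_def bump_def)
        qed (use P1 in \<open>simp add: z_def bump_def\<close>)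
        then have "tilde.en (\<lambda>x. z (\<psi> 1 x)) = tilde.en (\<lambda>x. (1 - t) * bump x + t)"
          by (rule tilde.en_cong)
        also have "\<dots> = (1 - t) powr p * A"
          unfolding tilde.en_shift tilde_homogeneous A_def using t by simp
        finally show ?thesis using True tilde.en_nonneg by simp
      next
        case False
        have "\<psi> i x \<noteq> P 1" if "x \<in> V0" for x
          using P_notin[OF one_in(1) i False] that by (metis imageI)
        then have "tilde.en (\<lambda>x. z (\<psi> i x)) = tilde.en (\<lambda>x. t * g (\<psi> i x))"
          by (intro tilde.en_cong) (simp add: z_def)
        also have "\<dots> = t powr p * tilde.en (\<lambda>x. g (\<psi> i x))"
          unfolding tilde_homogeneous using t by simp
        finally show ?thesis using False by simp
      qed
    qed
    also have "\<dots> = (1 - t) powr p * A + t powr p * C"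
      using one_in(2) unfolding sum.distrib C_def tilde.tot_def sum_distrib_left[symmetric]
      by (simp add: sum.delta)
    finally have "\<rho> * A \<le> (1 - t) powr p * A + t powr p * C"
      by (simp add: tilde_Lam A_def)
    moreover have "A \<le> \<rho> * A" using \<open>\<not> \<rho> < 1\<close> A by simp
    moreover have "(1 - t) powr p \<le> (1 - t) powr 1" using t p_gt_1 by (intro powr_mono') auto
    then have "(1 - t) powr p * A \<le> (1 - t) * A" using t A by simp
    ultimately show ?thesis by (simp add: algebra_simps)
  qed
  \<comment> \<open>Since \<open>p > 1\<close>, the factor \<open>t powr (p - 1) = s\<close> can be made so small that \<open>s * C < A\<close>.\<close>
  define s where "s = min (1/2) (A / (2 * (C + 1)))"
  define t where "t = s powr (1 / (p - 1))"
  have s: "0 < s" "s < 1" unfolding s_def using A C by auto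
  have t: "0 < t" "t < 1"
    unfolding t_def using s p_gt_1 powr_less_mono2[of "1 / (p - 1)" s 1] by auto
  have "t powr p = t * t powr (p - 1)"
    using t powr_add[of t 1 "p - 1"] by simp
  also have "t powr (p - 1) = s" unfolding t_def using s p_gt_1 by (simp add: powr_powr)
  finally have "A \<le> s * C" using bound[OF t] t by simp
  also have "s * C \<le> A / (2 * (C + 1)) * (C + 1)"
    using C s by (intro mult_mono) (auto simp: s_def)
  also have "\<dots> = A / 2"
  proof -
    have "A / (2 * D) * D = A / 2" if "0 < D" for D using that by simp
    then show ?thesis using C by (smt (verit))
  qed
  finally show False using A by simp
qed

text \<open>Any number strictly between \<open>\<rho>\<close> and 1 would do.\<close>

definition \<rho>' :: real where "\<rho>' = (1 + \<rho>) / 2"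

lemma rho': "\<rho> < \<rho>'" "\<rho>' < 1" "0 < \<rho>'"
  unfolding \<rho>'_def using rho_lt_1 rho_pos by auto

abbreviation \<Theta> :: "('a \<Rightarrow> real) \<Rightarrow> real" where
  "\<Theta> \<equiv> theta_bar k \<psi> V0 \<sigma> E"

lemma Theta:
  assumes "u \<in> extensional V0"
  shows Theta_pos: "0 < \<Theta> u" and Lam_Theta: "Lam (\<lambda>x. \<Theta> u * u x) = \<sigma> * E u"
proof -
  have "0 < \<Theta> u \<and> Lam (\<lambda>x. \<Theta> u * u x) = \<sigma> * E u"
  proof (cases "const_on V0 u")
    case True
    obtain q r where qr: "A2_params k \<psi> V0 E = (q, r)" by (cases "A2_params k \<psi> V0 E") auto
    have "\<exists>E''. A2_witness k \<psi> V0 E E'' q r"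
      using someI[of "\<lambda>(p, \<rho>). \<exists>E'. A2_witness k \<psi> V0 E E' p \<rho>" "(p, \<rho>)"] witness qr
      unfolding A2_params_def by auto
    then have "0 < r" by (auto simp: A2_witness_def)
    then have "0 < \<Theta> u" unfolding theta_bar_def using True qr sigma by simp
    moreover have "const_on V0 (\<lambda>x. \<Theta> u * u x)"
      using True unfolding const_on_def by auto
    then have "Lam (\<lambda>x. \<Theta> u * u x) = 0" by (simp only: Lam_zero_iff)
    moreover have "E u = 0" using True en_zero_iff[of u] en_extensional[OF assms] by simp
    ultimately show ?thesis by simp
  next
    case False
    have "0 < \<sigma> * E u"
      using sigma en_pos_iff[of u] False en_extensional[OF assms] by simp
    then have ex1: "\<exists>!\<theta>. 0 < \<theta> \<and> Lam (\<lambda>x. \<theta> * u x) = \<sigma> * E u"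
      by (rule Lam_ray_unique[OF False])
    moreover have "\<Theta> u = (THE \<theta>. 0 < \<theta> \<and> Lam (\<lambda>x. \<theta> * u x) = \<sigma> * E u)"
      unfolding theta_bar_def using False Renorm_eq_Lam
      by (auto intro!: arg_cong[where f = The])
    ultimately show ?thesis using theI'[OF ex1] by simp
  qed
  then show "0 < \<Theta> u" "Lam (\<lambda>x. \<Theta> u * u x) = \<sigma> * E u" by auto
qed

lemma Theta_ge:
  assumes "u \<in> extensional V0" "\<not> const_on V0 u" "Lam (\<lambda>x. t * u x) \<le> \<sigma> * E u"
  shows "t \<le> \<Theta> u"
  using Lam_ray_strict_mono[OF assms(2), of "\<Theta> u" t] Lam_Theta[OF assms(1)] Theta_pos[OF assms(1)]
    assms(3) by force

text \<open>At small scales \<open>E\<close> may be replaced by \<open>E'\<close>, for which the solution \<open>\<theta>\<close> of the renormalization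
  equation satisfies \<open>\<theta> powr p = \<sigma> / \<rho>\<close>. The margin between \<open>\<rho>\<close> and \<open>\<rho>'\<close> absorbs the error.\<close>

lemma Theta_powr_ge_small:
  obtains \<epsilon> where "0 < \<epsilon>" "\<And>u. u \<in> extensional V0 \<Longrightarrow> \<not> const_on V0 u \<Longrightarrow> osc V0 u < \<epsilon> \<Longrightarrow>
    \<sigma> / \<rho>' \<le> \<Theta> u powr p"
proof -
  \<comment> \<open>The tolerance for which \<open>(1 + \<eta>) * \<rho> = (1 - \<eta>) * \<rho>'\<close>.\<close>
  define \<eta> where "\<eta> = (\<rho>' - \<rho>) / (\<rho>' + \<rho>)"
  have \<eta>: "0 < \<eta>" unfolding \<eta>_def using rho' rho_pos by simp
  have \<eta>eq: "(1 + \<eta>) * \<rho> = (1 - \<eta>) * \<rho>'"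
    unfolding \<eta>_def using rho' rho_pos by (simp add: field_simps)
  define \<theta>0 where "\<theta>0 = (\<sigma> / \<rho>') powr (1 / p)"
  have \<theta>0: "0 < \<theta>0" "\<theta>0 powr p = \<sigma> / \<rho>'"
    unfolding \<theta>0_def using sigma rho' p_pos by (auto simp: powr_powr)
  obtain \<delta> where \<delta>: "0 < \<delta>"
    "\<And>f. osc V0 f < \<delta> \<Longrightarrow> (1 - \<eta>) * tilde.en f \<le> en f"
    "\<And>f. osc V0 f < \<delta> \<Longrightarrow> en f \<le> (1 + \<eta>) * tilde.en f"
    using en_close_to_tilde[OF \<eta>] by metis
  have "\<sigma> / \<rho>' \<le> \<Theta> u powr p"
    if u: "u \<in> extensional V0" "\<not> const_on V0 u" and small: "osc V0 u < min \<delta> (\<delta> / \<theta>0)" for u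
  proof -
    obtain z where z: "tilde.min_ext (\<lambda>x. \<theta>0 * u x) z" by (rule tilde.min_ext_exists)
    have "osc V0 (\<lambda>x. z (\<psi> i x)) < \<delta>" if "i \<in> {1..k}" for i
    proof -
      have "osc V0 (\<lambda>x. z (\<psi> i x)) \<le> \<theta>0 * osc V0 u"
        using tilde.min_ext_osc_cell_le[OF z that] osc_scale[of \<theta>0 u] \<theta>0 by simp
      also have "\<dots> < \<delta>" using small \<theta>0 by (simp add: field_simps)
      finally show ?thesis .
    qed
    then have "tot z \<le> (1 + \<eta>) * tilde.tot z"
      unfolding tot_def tilde.tot_def sum_distrib_left by (intro sum_mono \<delta>(3))
    also have "tilde.tot z = \<rho> * (\<sigma> / \<rho>' * tilde.en u)"
      using tilde.Lam_eq[OF z] \<theta>0 by (simp add: tilde_Lam tilde_homogeneous)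
    also have "(1 + \<eta>) * (\<rho> * (\<sigma> / \<rho>' * tilde.en u)) = ((1 + \<eta>) * \<rho>) * (\<sigma> / \<rho>') * tilde.en u"
      by simp
    also have "\<dots> = \<sigma> * ((1 - \<eta>) * tilde.en u)"
      unfolding \<eta>eq using rho' by simp
    also have "\<dots> \<le> \<sigma> * en u" using small sigma by (intro mult_left_mono \<delta>(2)) auto
    finally have "tot z \<le> \<sigma> * E u" by (simp add: en_extensional[OF u(1)])
    moreover have "Lam (\<lambda>x. \<theta>0 * u x) \<le> tot z" by (rule Lam_le) (rule tilde.min_extD(1)[OF z])
    ultimately have "\<theta>0 \<le> \<Theta> u" by (intro Theta_ge u) simp
    then have "\<theta>0 powr p \<le> \<Theta> u powr p" using \<theta>0 p_pos by (intro powr_mono2) auto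
    then show ?thesis using \<theta>0 by simp
  qed
  then show thesis using that[of "min \<delta> (\<delta> / \<theta>0)"] \<delta>(1) \<theta>0 by simp
qed

lemma osc_bounded_of_energy:
  obtains M where "1 \<le> M" "\<And>f. en f \<le> B \<Longrightarrow> osc V0 f \<le> M"
proof -
  obtain e where e: "0 < e" "\<And>f. 1 \<le> osc V0 f \<Longrightarrow> e * osc V0 f \<le> en f"
    using en_coercive[of 1] by (metis zero_less_one)
  have "osc V0 f \<le> max 1 (B / e)" if "en f \<le> B" for f
  proof (cases "1 \<le> osc V0 f")
    case True
    have "osc V0 f \<le> B / e" using e(2)[OF True] that e(1) by (simp add: pos_le_divide_eq mult.commute)
    then show ?thesis by simp
  qed simp
  then show thesis using that[of "max 1 (B / e)"] by simp
qed

text \<open>On data of bounded oscillation the renormalized energy grows at most linearly along short rays,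
  while the energy is bounded below if the oscillation is not small.\<close>

lemma Theta_ge_large:
  assumes "0 < \<epsilon>"
  obtains c where "0 < c" "\<And>u. u \<in> extensional V0 \<Longrightarrow> \<epsilon> \<le> osc V0 u \<Longrightarrow> osc V0 u \<le> M \<Longrightarrow> c \<le> \<Theta> u"
proof -
  obtain e where e: "0 < e" "\<And>f. \<epsilon> \<le> osc V0 f \<Longrightarrow> e * osc V0 f \<le> en f"
    using en_coercive[OF assms] by metis
  obtain B where B: "0 < B" "\<And>f. osc V0 f \<le> M \<Longrightarrow> en f \<le> B" by (rule en_bounded_osc[of M]) blast
  have k: "0 < real k" using one_in by simp
  define c where "c = min 1 (\<sigma> * (e * \<epsilon>) / (k * B))"
  have c: "0 < c" "c \<le> 1" unfolding c_def using sigma e assms B k by auto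
  have "c \<le> \<Theta> u" if u: "u \<in> extensional V0" "\<epsilon> \<le> osc V0 u" "osc V0 u \<le> M" for u
  proof -
    obtain z where z: "min_ext u z" by (rule min_ext_exists)
    have "Lam (\<lambda>x. c * u x) \<le> c * Lam u" using c by (intro Lam_scale_le) auto
    also have "Lam u = tot z" by (rule Lam_eq[OF z])
    also have "tot z \<le> (\<Sum>i=1..k. B)"
      unfolding tot_def using min_ext_osc_cell_le[OF z] u(3)
      by (intro sum_mono B(2)) (meson order_trans)
    also have "(\<Sum>i=1..k. B) = k * B" by simp
    also have "c * (k * B) \<le> \<sigma> * (e * \<epsilon>) / (k * B) * (k * B)"
      using k B by (intro mult_right_mono) (auto simp: c_def)
    also have "\<dots> = \<sigma> * (e * \<epsilon>)" using k B by simp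
    also have "e * \<epsilon> \<le> e * osc V0 u" using u e by simp
    also have "\<dots> \<le> en u" by (rule e(2)[OF u(2)])
    finally have "Lam (\<lambda>x. c * u x) \<le> \<sigma> * E u"
      using c sigma by (simp add: en_extensional[OF u(1)])
    moreover have "\<not> const_on V0 u" using u(2) assms osc_pos_iff[of u] by simp
    ultimately show ?thesis using Theta_ge[OF u(1)] by blast
  qed
  then show thesis using that c(1) by blast
qed

text \<open>\<open>Z u\<close> is the solution on the first level multiplied by \<open>\<Theta> u\<close>, so that its restrictions to the
  cells are the boundary data of the next step without a further factor.\<close>

definition Z :: "('a \<Rightarrow> real) \<Rightarrow> 'a \<Rightarrow> real" where
  "Z u = (SOME z. min_ext (\<lambda>x. \<Theta> u * u x) z)"

definition child :: "('a \<Rightarrow> real) \<Rightarrow> nat \<Rightarrow> 'a \<Rightarrow> real" where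
  "child u i = restrict (\<lambda>x. Z u (\<psi> i x)) V0"

lemma min_ext_Z: "min_ext (\<lambda>x. \<Theta> u * u x) (Z u)"
  unfolding Z_def using min_ext_exists[of "\<lambda>x. \<Theta> u * u x"] by (metis someI)

lemma child_extensional: "child u i \<in> extensional V0"
  by (simp add: child_def)

lemma osc_child: "osc V0 (child u i) = osc V0 (\<lambda>x. Z u (\<psi> i x))"
  by (rule osc_cong) (simp add: child_def)

lemma sum_energy_children:
  assumes "u \<in> extensional V0"
  shows "(\<Sum>i=1..k. E (child u i)) = \<sigma> * E u"
  using Lam_eq[OF min_ext_Z[of u]] Lam_Theta[OF assms] by (simp add: tot_def en_def child_def)

lemma E_nonneg: "u \<in> extensional V0 \<Longrightarrow> 0 \<le> E u"
  using en_nonneg[of u] en_extensional[of u] by simp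

lemma energy_child_le:
  assumes "u \<in> extensional V0" "i \<in> {1..k}"
  shows "E (child u i) \<le> E u"
proof -
  have "E (child u i) \<le> (\<Sum>i=1..k. E (child u i))"
    using assms(2) E_nonneg[OF child_extensional] by (intro member_le_sum) auto
  also have "\<dots> = \<sigma> * E u" by (rule sum_energy_children[OF assms(1)])
  also have "\<dots> \<le> E u" using sigma E_nonneg[OF assms(1)] by (simp add: mult_left_le_one_le)
  finally show ?thesis .
qed

lemma osc_child_le:
  assumes "u \<in> extensional V0" "i \<in> {1..k}"
  shows "osc V0 (child u i) \<le> \<Theta> u * osc V0 u"
  using min_ext_osc_cell_le[OF min_ext_Z[of u] assms(2)] osc_scale[of "\<Theta> u" u] Theta_pos[OF assms(1)]
  by (simp add: osc_child)

text \<open>One estimate for both regimes. If the oscillation of \<open>u\<close> is small, the factor of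
  \<open>\<Theta> u powr p\<close> already compensates. Otherwise the oscillation of the solution contracts, and a high power of
  the contraction ratio beats the lower bound of \<open>\<Theta>\<close>.\<close>

lemma child_osc_power_estimate:
  obtains \<alpha> where "0 < \<alpha>" "\<And>u i. u \<in> extensional V0 \<Longrightarrow> E u \<le> B \<Longrightarrow> i \<in> {1..k} \<Longrightarrow>
    osc V0 (child u i) ^ \<alpha> \<le> \<rho>' / \<sigma> * \<Theta> u powr p * (\<Theta> u * osc V0 u) ^ \<alpha>"
proof -
  obtain \<epsilon> where \<epsilon>: "0 < \<epsilon>" "\<And>u. u \<in> extensional V0 \<Longrightarrow> \<not> const_on V0 u \<Longrightarrow> osc V0 u < \<epsilon> \<Longrightarrow>
    \<sigma> / \<rho>' \<le> \<Theta> u powr p" by (rule Theta_powr_ge_small) blast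
  obtain M where M: "1 \<le> M" "\<And>f. en f \<le> B \<Longrightarrow> osc V0 f \<le> M" by (rule osc_bounded_of_energy[of B]) blast
  obtain c where c: "0 < c" "\<And>u. u \<in> extensional V0 \<Longrightarrow> \<epsilon> \<le> osc V0 u \<Longrightarrow> osc V0 u \<le> M \<Longrightarrow> c \<le> \<Theta> u"
    using Theta_ge_large[OF \<epsilon>(1)] by metis
  have "0 < c * \<epsilon>" using c \<epsilon> by simp
  from uniform_contraction[OF this]
  obtain d where d: "0 < d" "d \<le> 1"
    "\<And>w z i. min_ext w z \<Longrightarrow> c * \<epsilon> \<le> osc V0 w \<Longrightarrow> osc V0 w \<le> 2 * M \<Longrightarrow> i \<in> {1..k} \<Longrightarrow>
       osc V0 (\<lambda>x. z (\<psi> i x)) \<le> (1 - d) * osc V0 w" by metis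
  define q where "q = max (1/2) (1 - d)"
  have q: "0 < q" "q < 1" unfolding q_def using d by auto
  have "0 < \<rho>' / \<sigma> * c powr p" using c rho' sigma by simp
  then obtain n where n: "q ^ n < \<rho>' / \<sigma> * c powr p" using real_arch_pow_inv q by metis
  have "q ^ Suc n \<le> q ^ n" using q by (simp add: mult_left_le_one_le)
  then have qn: "q ^ Suc n \<le> \<rho>' / \<sigma> * c powr p" using n by linarith
  have "osc V0 (child u i) ^ Suc n \<le> \<rho>' / \<sigma> * \<Theta> u powr p * (\<Theta> u * osc V0 u) ^ Suc n"
    if u: "u \<in> extensional V0" "E u \<le> B" and i: "i \<in> {1..k}" for u i
  proof -
    let ?w = "\<lambda>x. \<Theta> u * u x"
    have \<Theta>: "0 < \<Theta> u" by (rule Theta_pos[OF u(1)])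
    have w: "osc V0 ?w = \<Theta> u * osc V0 u" using osc_scale \<Theta> by simp
    have w0: "0 \<le> (\<Theta> u * osc V0 u) ^ Suc n" using \<Theta> osc_nonneg[of u] by simp
    have le: "osc V0 (child u i) \<le> \<Theta> u * osc V0 u" by (rule osc_child_le[OF u(1) i])
    consider "const_on V0 u" | "\<not> const_on V0 u" "osc V0 u < \<epsilon>" | "\<epsilon> \<le> osc V0 u" by force
    then show ?thesis
    proof cases
      case 1
      then have "osc V0 (child u i) = 0"
        using le osc_nonneg[of "child u i"] by (simp add: const_on_iff_osc)
      then show ?thesis using w0 rho' sigma by simp
    next
      case 2
      have "\<sigma> / \<rho>' \<le> \<Theta> u powr p" by (rule \<epsilon>(2)[OF u(1) 2])
      then have "1 \<le> \<rho>' / \<sigma> * \<Theta> u powr p" using rho' sigma by (simp add: field_simps)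
      then have "1 * (\<Theta> u * osc V0 u) ^ Suc n \<le> \<rho>' / \<sigma> * \<Theta> u powr p * (\<Theta> u * osc V0 u) ^ Suc n"
        using w0 by (rule mult_right_mono)
      moreover have "osc V0 (child u i) ^ Suc n \<le> (\<Theta> u * osc V0 u) ^ Suc n"
        using le osc_nonneg by (rule power_mono)
      ultimately show ?thesis by linarith
    next
      case 3
      have oM: "osc V0 u \<le> M" using M(2)[of u] u en_extensional by simp
      have c\<Theta>: "c \<le> \<Theta> u" by (rule c(2)[OF u(1) 3 oM])
      have "osc V0 (child u i) \<le> q * (\<Theta> u * osc V0 u)"
        \<comment> \<open>No upper bound of \<open>\<Theta> u\<close> is at hand. But if it makes the data exceed \<open>2 * M\<close> in oscillation, then
          the energy bound on the cells, which keeps them below \<open>M\<close>, is a contraction by itself.\<close>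
      proof (cases "osc V0 ?w \<le> 2 * M")
        case True
        have "c * \<epsilon> \<le> osc V0 ?w" unfolding w using c\<Theta> 3 c \<epsilon> by (intro mult_mono) auto
        then have "osc V0 (child u i) \<le> (1 - d) * (\<Theta> u * osc V0 u)"
          using d(3)[OF min_ext_Z _ True i] unfolding osc_child w by simp
        also have "\<dots> \<le> q * (\<Theta> u * osc V0 u)"
          using \<Theta> osc_nonneg[of u] unfolding q_def by (intro mult_right_mono) auto
        finally show ?thesis .
      next
        case False
        have "E (child u i) \<le> B" using energy_child_le[OF u(1) i] u(2) by simp
        then have "osc V0 (child u i) \<le> M"
          using M(2)[of "child u i"] en_extensional[OF child_extensional] by simp
        also have "M \<le> 1/2 * (\<Theta> u * osc V0 u)" using False unfolding w by simp
        also have "\<dots> \<le> q * (\<Theta> u * osc V0 u)"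
          using \<Theta> osc_nonneg[of u] unfolding q_def by (intro mult_right_mono) auto
        finally show ?thesis .
      qed
      then have "osc V0 (child u i) ^ Suc n \<le> (q * (\<Theta> u * osc V0 u)) ^ Suc n"
        using osc_nonneg by (rule power_mono)
      also have "\<dots> = q ^ Suc n * (\<Theta> u * osc V0 u) ^ Suc n" by (rule power_mult_distrib)
      also have "\<dots> \<le> (\<rho>' / \<sigma> * \<Theta> u powr p) * (\<Theta> u * osc V0 u) ^ Suc n"
      proof (rule mult_right_mono[OF _ w0])
        have "c powr p \<le> \<Theta> u powr p" using c\<Theta> c p_pos by (intro powr_mono2) auto
        then have "\<rho>' / \<sigma> * c powr p \<le> \<rho>' / \<sigma> * \<Theta> u powr p"
          using rho' sigma by (intro mult_left_mono) auto
        then show "q ^ Suc n \<le> \<rho>' / \<sigma> * \<Theta> u powr p" using qn by linarith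
      qed
      finally show ?thesis .
    qed
  qed
  then show thesis using that[of "Suc n"] by blast
qed

text \<open>For small oscillation this is the homogeneity of \<open>E'\<close>; on the remaining bounded range of
  oscillations both sides are comparable to constants.\<close>

lemma energy_ge_osc_powr:
  obtains c where "0 < c" "\<And>f. en f \<le> B \<Longrightarrow> c * osc V0 f powr p \<le> en f"
proof -
  obtain M where M: "1 \<le> M" "\<And>f. en f \<le> B \<Longrightarrow> osc V0 f \<le> M" by (rule osc_bounded_of_energy[of B]) blast
  obtain \<delta> where \<delta>: "0 < \<delta>" "\<And>f. osc V0 f < \<delta> \<Longrightarrow> (1 - 1/2) * tilde.en f \<le> en f"
    using en_close_to_tilde[of "1/2"] by (metis half_gt_zero zero_less_one)
  obtain e where e: "0 < e" "\<And>f. \<delta> \<le> osc V0 f \<Longrightarrow> e * osc V0 f \<le> en f"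
    using en_coercive[OF \<delta>(1)] by metis
  obtain e' where e': "0 < e'" "\<And>f. 1 \<le> osc V0 f \<Longrightarrow> e' * osc V0 f \<le> tilde.en f"
    using tilde.en_coercive[of 1] by (metis zero_less_one)
  define c where "c = min (e' / 2) (e * \<delta> / M powr p)"
  have c: "0 < c" unfolding c_def using e e' \<delta> M by simp
  have "c * osc V0 f powr p \<le> en f" if f: "en f \<le> B" for f
  proof (cases "osc V0 f < \<delta>")
    case True
    have "e' * osc V0 f powr p \<le> tilde.en f"
    proof (cases "osc V0 f = 0")
      case True then show ?thesis using tilde.en_nonneg by simp
    next
      case False
      then have s: "0 < osc V0 f" using osc_nonneg[of f] by simp
      let ?g = "\<lambda>x. 1 / osc V0 f * f x"
      have "osc V0 ?g = 1" using osc_scale[of "1 / osc V0 f" f] s by simp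
      then have "e' \<le> tilde.en ?g" using e'(2)[of ?g] by simp
      then have "e' * osc V0 f powr p \<le> tilde.en ?g * osc V0 f powr p"
        by (rule mult_right_mono) simp
      also have "\<dots> = tilde.en f"
        unfolding tilde_homogeneous using s by (simp add: powr_divide)
      finally show ?thesis .
    qed
    moreover have "c \<le> e' / 2" unfolding c_def by (rule min.cobounded1)
    then have "c * osc V0 f powr p \<le> e' / 2 * osc V0 f powr p"
      by (rule mult_right_mono) simp
    ultimately show ?thesis using \<delta>(2)[OF True] by simp
  next
    case False
    have "osc V0 f powr p \<le> M powr p"
      using M(2)[OF f] osc_nonneg p_pos by (intro powr_mono2) auto
    then have "c * osc V0 f powr p \<le> e * \<delta> / M powr p * M powr p"
      using e \<delta> c by (intro mult_mono) (auto simp: c_def)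
    also have "\<dots> = e * \<delta>" using M by simp
    also have "\<dots> \<le> e * osc V0 f" using False e by simp
    also have "\<dots> \<le> en f" using e(2) False by simp
    finally show ?thesis .
  qed
  then show thesis using that c by blast
qed

end


section \<open>Cells of the fractal\<close>

lemma words_0: "words k 0 = {[]}"
  by (auto simp: words_def)

lemma words_Suc: "words k (Suc n) = (\<lambda>(i, w). i # w) ` ({1..k} \<times> words k n)"
  by (auto simp: words_def length_Suc_conv image_iff)

lemma finite_words: "finite (words k n)"
  by (induction n) (auto simp: words_0 words_Suc)

lemma sum_words_Suc: "(\<Sum>w\<in>words k (Suc n). f w) = (\<Sum>i=1..k. \<Sum>w\<in>words k n. f (i # w))"
proof -
  have "inj_on (\<lambda>(i, w). i # w) ({1..k} \<times> words k n)" by (auto simp: inj_on_def)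
  then show ?thesis
    unfolding words_Suc by (simp add: sum.reindex sum.cartesian_product case_prod_unfold)
qed

lemma psi_word_append: "psi_word \<psi> (w @ w') x = psi_word \<psi> w (psi_word \<psi> w' x)"
  by (induction w) auto

lemma compact_disjoint_separated:
  fixes S T :: "'a::metric_space set"
  assumes "compact S" "compact T" "S \<inter> T = {}"
  obtains d where "0 < d" "\<And>x y. x \<in> S \<Longrightarrow> y \<in> T \<Longrightarrow> d \<le> dist x y"
proof (cases "S \<times> T = {}")
  case True
  then show thesis using that[of 1] by auto
next
  case False
  have "continuous_on (S \<times> T) (\<lambda>q. dist (fst q) (snd q))" by (intro continuous_intros)
  from continuous_attains_inf[OF compact_Times[OF assms(1,2)] False this]
  obtain q where q: "q \<in> S \<times> T" "\<And>r. r \<in> S \<times> T \<Longrightarrow> dist (fst q) (snd q) \<le> dist (fst r) (snd r)"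
    by blast
  show thesis
  proof (rule that[of "dist (fst q) (snd q)"])
    show "0 < dist (fst q) (snd q)" using q(1) assms(3) by auto
    show "dist (fst q) (snd q) \<le> dist x y" if "x \<in> S" "y \<in> T" for x y
      using q(2)[of "(x, y)"] that by simp
  qed
qed

context fractal
begin

lemma psi_word_in_F: "set w \<subseteq> {1..k} \<Longrightarrow> x \<in> F \<Longrightarrow> psi_word \<psi> w x \<in> F"
  by (induction w) (simp_all add: psi_in_F)

lemma dist_psi_word:
  "set w \<subseteq> {1..k} \<Longrightarrow> x \<in> F \<Longrightarrow> y \<in> F \<Longrightarrow>
     dist (psi_word \<psi> w x) (psi_word \<psi> w y) = dist x y / 2 ^ length w"
  by (induction w) (simp_all add: psi_dist psi_word_in_F)

lemma compact_cell:
  assumes "set w \<subseteq> {1..k}"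
  shows "compact (psi_word \<psi> w ` F)"
proof (rule compact_continuous_image[OF _ F_compact])
  show "continuous_on F (psi_word \<psi> w)"
    unfolding continuous_on_iff
  proof (intro ballI allI impI exI conjI)
    fix x e y assume *: "x \<in> F" "(0::real) < e" "y \<in> F" "dist y x < e"
    have "dist (psi_word \<psi> w y) (psi_word \<psi> w x) \<le> dist y x"
      using dist_psi_word[OF assms *(3,1)] divide_left_mono[of 1 "2 ^ length w" "dist y x"] by simp
    then show "dist (psi_word \<psi> w y) (psi_word \<psi> w x) < e" using * by simp
  qed
qed

lemma F_subset_cells: "x \<in> F \<Longrightarrow> \<exists>w\<in>words k n. x \<in> psi_word \<psi> w ` F"
proof (induction n arbitrary: x)
  case 0
  then show ?case by (simp add: words_0)
next
  case (Suc n)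
  obtain i y where iy: "i \<in> {1..k}" "y \<in> F" "x = \<psi> i y" using Suc.prems F_self_similar by blast
  obtain w where w: "w \<in> words k n" "y \<in> psi_word \<psi> w ` F" using Suc.IH[OF iy(2)] by blast
  have "i # w \<in> words k (Suc n)" using iy(1) w(1) by (auto simp: words_Suc)
  moreover have "x \<in> psi_word \<psi> (i # w) ` F" using w(2) iy(3) by auto
  ultimately show ?case by blast
qed

lemma V_infty_eq: "V_infty k \<psi> V0 = {psi_word \<psi> w x | w x. set w \<subseteq> {1..k} \<and> x \<in> V0}"
  by (auto simp: V_infty_def V_level_def words_def)

lemma V_infty_subset_F: "V_infty k \<psi> V0 \<subseteq> F"
  unfolding V_infty_eq using psi_word_in_F V_zero_subset by blast

lemma closure_V_infty: "closure (V_infty k \<psi> V0) = F"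
proof
  show "closure (V_infty k \<psi> V0) \<subseteq> F"
    by (rule closure_minimal[OF V_infty_subset_F compact_imp_closed[OF F_compact]])
next
  obtain D where D: "\<And>x y. x \<in> F \<Longrightarrow> y \<in> F \<Longrightarrow> dist x y \<le> D"
    using compact_imp_bounded[OF F_compact] unfolding bounded_two_points by blast
  obtain a where a: "a \<in> V0" using neV by blast
  show "F \<subseteq> closure (V_infty k \<psi> V0)"
  proof (intro subsetI, unfold closure_approachable, intro allI impI)
    fix x and e :: real assume x: "x \<in> F" and e: "0 < e"
    have "(\<lambda>n. D / 2 ^ n) \<longlonglongrightarrow> 0" by (intro LIMSEQ_divide_realpow_zero) simp
    then have "\<forall>\<^sub>F n in sequentially. D / 2 ^ n < e" using e by (rule order_tendstoD)
    then obtain n where n: "D / 2 ^ n < e" by (meson eventually_sequentially order_refl)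
    obtain w y where w: "w \<in> words k n" "y \<in> F" "x = psi_word \<psi> w y"
      using F_subset_cells[OF x, of n] by blast
    have wk: "set w \<subseteq> {1..k}" "length w = n" using w(1) by (auto simp: words_def)
    have aF: "a \<in> F" using a V_zero_subset by blast
    have "dist (psi_word \<psi> w a) x \<le> D / 2 ^ n"
      unfolding w(3) dist_psi_word[OF wk(1) aF w(2)] wk(2)
      by (intro divide_right_mono D aF w(2)) simp
    then show "\<exists>y\<in>V_infty k \<psi> V0. dist y x < e"
      using n wk(1) a unfolding V_infty_eq by force
  qed
qed

lemma psi_word_replicate_corner: "j \<in> {1..N} \<Longrightarrow> psi_word \<psi> (replicate n j) (P j) = P j"
  by (induction n) (simp_all add: psi_fix)

end

section \<open>The solution on the vertices\<close>

context nonlinear_energy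
begin

text \<open>For the solution \<open>v\<close> with boundary data \<open>u\<close>, \<open>factor w u\<close> is the number \<open>\<theta>\<^sub>w\<close> of the nonlinear
  energy, \<open>state w u\<close> is \<open>\<theta>\<^sub>w v \<circ> \<psi>\<^sub>w\<close> on \<open>V0\<close>, and \<open>val u w\<close> is \<open>v \<circ> \<psi>\<^sub>w\<close> on \<open>V0\<close>. The recursion over
  the first letter is that of \<open>theta_word\<close>.\<close>

primrec state :: "nat list \<Rightarrow> ('a \<Rightarrow> real) \<Rightarrow> 'a \<Rightarrow> real" where
  "state [] u = u"
| "state (i # w) u = state w (child u i)"

primrec factor :: "nat list \<Rightarrow> ('a \<Rightarrow> real) \<Rightarrow> real" where
  "factor [] u = 1"
| "factor (i # w) u = factor w (child u i) * \<Theta> u"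

definition val :: "('a \<Rightarrow> real) \<Rightarrow> nat list \<Rightarrow> 'a \<Rightarrow> real" where
  "val u w x = state w u x / factor w u"

lemma val_Nil: "val u [] x = u x"
  by (simp add: val_def)

lemma val_Cons: "val u (i # w) x = val (child u i) w x / \<Theta> u"
  by (simp add: val_def)

lemma state_append: "state (w @ w') u = state w' (state w u)"
  by (induction w arbitrary: u) auto

lemma factor_append: "factor (w @ w') u = factor w' (state w u) * factor w u"
  by (induction w arbitrary: u) auto

lemma val_append: "val u (w @ w') x = val (state w u) w' x / factor w u"
  by (simp add: val_def state_append factor_append)

lemma state_extensional: "u \<in> extensional V0 \<Longrightarrow> state w u \<in> extensional V0"
  by (induction w arbitrary: u) (auto simp: child_extensional)

lemma factor_pos: "u \<in> extensional V0 \<Longrightarrow> 0 < factor w u"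
  by (induction w arbitrary: u) (auto simp: child_extensional Theta_pos)

lemma sum_energy_state:
  "u \<in> extensional V0 \<Longrightarrow> (\<Sum>w\<in>words k n. E (state w u)) = \<sigma> ^ n * E u"
proof (induction n arbitrary: u)
  case 0
  then show ?case by (simp add: words_0)
next
  case (Suc n)
  have "(\<Sum>w\<in>words k (Suc n). E (state w u)) = (\<Sum>i=1..k. \<sigma> ^ n * E (child u i))"
    by (simp add: sum_words_Suc Suc.IH[OF child_extensional])
  also have "\<dots> = \<sigma> ^ n * (\<sigma> * E u)"
    unfolding sum_distrib_left[symmetric] sum_energy_children[OF Suc.prems] ..
  finally show ?case by simp
qed

lemma energy_state_le:
  assumes "u \<in> extensional V0" "w \<in> words k n"
  shows "E (state w u) \<le> \<sigma> ^ n * E u"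
  unfolding sum_energy_state[OF assms(1), symmetric] using assms E_nonneg state_extensional
  by (intro member_le_sum finite_words) auto

text \<open>The oscillation \<open>O\<close> on a cell of level \<open>n\<close> with factor \<open>T\<close> satisfies
  \<open>O ^ \<alpha> \<le> C (\<rho>' / \<sigma>) ^ n T powr p\<close> by iterating the one-step estimate, and
  \<open>T powr p * O powr p \<le> C \<sigma> ^ n\<close> by conservation of energy. In the product the factors \<open>T\<close> and
  the powers of \<open>\<sigma>\<close> cancel.\<close>

lemma osc_val_uniform_decay:
  assumes u: "u \<in> extensional V0" and \<epsilon>: "0 < \<epsilon>"
  obtains n where "\<And>w. w \<in> words k n \<Longrightarrow> osc V0 (val u w) < \<epsilon>"
proof -
  obtain \<alpha> where \<alpha>: "0 < \<alpha>" "\<And>u' i. u' \<in> extensional V0 \<Longrightarrow> E u' \<le> E u \<Longrightarrow> i \<in> {1..k} \<Longrightarrow>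
    osc V0 (child u' i) ^ \<alpha> \<le> \<rho>' / \<sigma> * \<Theta> u' powr p * (\<Theta> u' * osc V0 u') ^ \<alpha>"
    by (rule child_osc_power_estimate[of "E u"]) blast
  obtain c where c: "0 < c" "\<And>f. en f \<le> E u \<Longrightarrow> c * osc V0 f powr p \<le> en f"
    by (rule energy_ge_osc_powr[of "E u"]) blast
  have iter: "osc V0 (val u' w) ^ \<alpha> \<le> (\<rho>' / \<sigma>) ^ length w * factor w u' powr p * osc V0 u' ^ \<alpha>"
    if "u' \<in> extensional V0" "E u' \<le> E u" "set w \<subseteq> {1..k}" for u' w
    using that
  proof (induction w arbitrary: u')
    case Nil
    have "osc V0 (val u' []) = osc V0 u'" by (rule osc_cong) (simp add: val_Nil)
    then show ?case by simp
  next
    case (Cons i w)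
    have i: "i \<in> {1..k}" and w: "set w \<subseteq> {1..k}" using Cons.prems by auto
    have \<Theta>: "0 < \<Theta> u'" by (rule Theta_pos[OF Cons.prems(1)])
    have fpos: "0 < factor w (child u' i)" by (rule factor_pos[OF child_extensional])
    let ?r = "(\<rho>' / \<sigma>) ^ length w * factor w (child u' i) powr p"
    have r0: "0 \<le> ?r" using rho' sigma by simp
    have "osc V0 (val u' (i # w)) = osc V0 (\<lambda>x. 1 / \<Theta> u' * val (child u' i) w x)"
      by (rule osc_cong) (simp add: val_Cons)
    also have "\<dots> = 1 / \<Theta> u' * osc V0 (val (child u' i) w)" using \<Theta> by (intro osc_scale) simp
    finally have "osc V0 (val u' (i # w)) ^ \<alpha> = osc V0 (val (child u' i) w) ^ \<alpha> / \<Theta> u' ^ \<alpha>"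
      by (simp add: power_divide)
    also have "\<dots> \<le> ?r * osc V0 (child u' i) ^ \<alpha> / \<Theta> u' ^ \<alpha>"
      using Cons.IH[OF child_extensional _ w] energy_child_le[OF Cons.prems(1) i] Cons.prems(2) \<Theta>
      by (intro divide_right_mono) auto
    also have "\<dots> \<le> ?r * (\<rho>' / \<sigma> * \<Theta> u' powr p * (\<Theta> u' * osc V0 u') ^ \<alpha>) / \<Theta> u' ^ \<alpha>"
      using \<alpha>(2)[OF Cons.prems(1,2) i] r0 \<Theta> by (intro divide_right_mono mult_left_mono) auto
    also have "\<dots> = (\<rho>' / \<sigma>) ^ length (i # w) * (factor w (child u' i) powr p * \<Theta> u' powr p)
        * osc V0 u' ^ \<alpha>"
      using \<Theta> by (simp add: power_mult_distrib)
    also have "factor w (child u' i) powr p * \<Theta> u' powr p = factor (i # w) u' powr p"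
      using fpos \<Theta> by (simp add: powr_mult)
    finally show ?case .
  qed
  define C where "C = osc V0 u ^ \<alpha> * E u"
  have main: "c * osc V0 (val u w) powr p * osc V0 (val u w) ^ \<alpha> \<le> \<rho>' ^ n * C"
    if w: "w \<in> words k n" for w n
  proof -
    have wk: "set w \<subseteq> {1..k}" "length w = n" using w by (auto simp: words_def)
    let ?T = "factor w u" and ?O = "osc V0 (val u w)"
    have T: "0 < ?T" by (rule factor_pos[OF u])
    have sT: "osc V0 (state w u) = ?T * ?O"
    proof -
      have "osc V0 (state w u) = osc V0 (\<lambda>x. ?T * val u w x)"
        by (rule osc_cong) (use T in \<open>simp add: val_def\<close>)
      then show ?thesis using osc_scale[of ?T "val u w"] T by simp
    qed
    have "\<sigma> ^ n \<le> 1" using sigma by (simp add: power_le_one)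
    then have "\<sigma> ^ n * E u \<le> E u" using E_nonneg[OF u] sigma by (simp add: mult_left_le_one_le)
    then have Ew: "E (state w u) \<le> E u" using energy_state_le[OF u w] by simp
    have "c * osc V0 (state w u) powr p \<le> en (state w u)"
      using Ew by (intro c(2)) (simp add: en_extensional state_extensional u)
    also have "\<dots> \<le> \<sigma> ^ n * E u"
      using energy_state_le[OF u w] by (simp add: en_extensional state_extensional u)
    finally have e: "c * (?T powr p * ?O powr p) \<le> \<sigma> ^ n * E u"
      unfolding sT using T osc_nonneg[of "val u w"] by (simp add: powr_mult)
    have "c * ?O powr p * ?O ^ \<alpha> \<le> c * ?O powr p * ((\<rho>' / \<sigma>) ^ n * ?T powr p * osc V0 u ^ \<alpha>)"
      using iter[OF u _ wk(1)] c(1) unfolding wk(2) by (intro mult_left_mono) auto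
    also have "\<dots> = (c * (?T powr p * ?O powr p)) * ((\<rho>' / \<sigma>) ^ n * osc V0 u ^ \<alpha>)"
      by (simp add: algebra_simps)
    also have "\<dots> \<le> (\<sigma> ^ n * E u) * ((\<rho>' / \<sigma>) ^ n * osc V0 u ^ \<alpha>)"
      using e rho' sigma osc_nonneg[of u] by (intro mult_right_mono) auto
    also have "\<dots> = \<rho>' ^ n * C" unfolding C_def using sigma by (simp add: power_divide)
    finally show ?thesis .
  qed
  define y where "y = c * \<epsilon> powr p * \<epsilon> ^ \<alpha>"
  have y: "0 < y" unfolding y_def using c \<epsilon> by simp
  have "(\<lambda>n. \<rho>' ^ n * C) \<longlonglongrightarrow> 0 * C"
    using rho' by (intro tendsto_mult_right LIMSEQ_realpow_zero) auto
  then have "\<forall>\<^sub>F n in sequentially. \<rho>' ^ n * C < y" using y by (intro order_tendstoD(2)) auto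
  then obtain n where n: "\<rho>' ^ n * C < y" by (meson eventually_sequentially order_refl)
  have "osc V0 (val u w) < \<epsilon>" if "w \<in> words k n" for w
  proof (rule ccontr)
    assume "\<not> osc V0 (val u w) < \<epsilon>"
    then have ge: "\<epsilon> \<le> osc V0 (val u w)" by simp
    have "y \<le> c * osc V0 (val u w) powr p * osc V0 (val u w) ^ \<alpha>"
      unfolding y_def using ge c \<epsilon> p_pos
      by (intro mult_mono powr_mono2 power_mono) auto
    then show False using main[OF that] n by simp
  qed
  then show thesis by (rule that)
qed

lemma val_bounds:
  assumes "u \<in> extensional V0" "set w \<subseteq> {1..k}" "x \<in> V0"
  shows "Min (u ` V0) \<le> val u w x \<and> val u w x \<le> Max (u ` V0)"
  using assms
proof (induction w arbitrary: u)
  case Nil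
  then show ?case by (simp add: val_Nil Min_le_at le_Max_at)
next
  case (Cons i w)
  have i: "i \<in> {1..k}" and w: "set w \<subseteq> {1..k}" using Cons.prems by auto
  have \<Theta>: "0 < \<Theta> u" by (rule Theta_pos[OF Cons.prems(1)])
  have "\<Theta> u * Min (u ` V0) \<le> child u i y \<and> child u i y \<le> \<Theta> u * Max (u ` V0)" if "y \<in> V0" for y
  proof -
    obtain a where a: "a \<in> V0" "\<Theta> u * u a = Min ((\<lambda>x. \<Theta> u * u x) ` V0)" by (rule Min_attained)
    obtain b where b: "b \<in> V0" "\<Theta> u * u b = Max ((\<lambda>x. \<Theta> u * u x) ` V0)" by (rule Max_attained)
    have "\<Theta> u * u a \<le> Z u (\<psi> i y)" "Z u (\<psi> i y) \<le> \<Theta> u * u b"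
      using min_extD(2,3)[OF min_ext_Z psi_in_V1[OF i that], of u] a b by auto
    moreover have "\<Theta> u * Min (u ` V0) \<le> \<Theta> u * u a" "\<Theta> u * u b \<le> \<Theta> u * Max (u ` V0)"
      using \<Theta> Min_le_at[OF a(1), of u] le_Max_at[OF b(1), of u] by simp_all
    ultimately show ?thesis using that by (simp add: child_def)
  qed
  then have "\<Theta> u * Min (u ` V0) \<le> Min (child u i ` V0)" "Max (child u i ` V0) \<le> \<Theta> u * Max (u ` V0)"
    using Min_attained[of "child u i"] Max_attained[of "child u i"] by metis+
  moreover have "Min (child u i ` V0) \<le> val (child u i) w x \<and> val (child u i) w x \<le> Max (child u i ` V0)"
    by (rule Cons.IH[OF child_extensional w Cons.prems(3)])
  ultimately have "\<Theta> u * Min (u ` V0) \<le> val (child u i) w x" "val (child u i) w x \<le> \<Theta> u * Max (u ` V0)"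
    by linarith+
  then show ?case unfolding val_Cons using \<Theta> by (simp add: field_simps)
qed

lemma val_subcell_close:
  assumes u: "u \<in> extensional V0" and "set w' \<subseteq> {1..k}" "x \<in> V0" "y \<in> V0"
  shows "\<bar>val u (w @ w') x - val u w y\<bar> \<le> osc V0 (val u w)"
proof -
  have T: "0 < factor w u" by (rule factor_pos[OF u])
  let ?s = "state w u"
  have bds: "Min (?s ` V0) \<le> val ?s w' x" "val ?s w' x \<le> Max (?s ` V0)"
    using val_bounds[OF state_extensional[OF u] assms(2,3)] by auto
  have "\<bar>val ?s w' x - ?s y\<bar> \<le> osc V0 ?s"
    using bds Min_le_at[OF assms(4), of ?s] le_Max_at[OF assms(4), of ?s]
    unfolding osc_def by linarith
  then have "\<bar>val ?s w' x - ?s y\<bar> / factor w u \<le> 1 / factor w u * osc V0 ?s"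
    using T by (simp add: divide_right_mono)
  also have "1 / factor w u * osc V0 ?s = osc V0 (\<lambda>x. 1 / factor w u * ?s x)"
    using T by (intro osc_scale[symmetric]) simp
  also have "\<dots> = osc V0 (val u w)" by (rule osc_cong) (simp add: val_def)
  also have "\<bar>val ?s w' x - ?s y\<bar> / factor w u = \<bar>val u (w @ w') x - val u w y\<bar>"
    unfolding val_append val_def[of u w] using T
    by (simp add: diff_divide_distrib[symmetric] abs_divide)
  finally show ?thesis .
qed

lemma val_replicate_corner:
  assumes "j \<in> {1..N}"
  shows "u \<in> extensional V0 \<Longrightarrow> val u (replicate n j) (P j) = u (P j)"
proof (induction n arbitrary: u)
  case 0
  then show ?case by (simp add: val_Nil)
next
  case (Suc n)
  have "child u j (P j) = Z u (P j)"
    using P_in_V0[OF assms] psi_fix[OF assms] by (simp add: child_def)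
  also have "\<dots> = \<Theta> u * u (P j)" by (rule min_extD(1)[OF min_ext_Z P_in_V0[OF assms]])
  finally show ?case
    using Suc.IH[OF child_extensional] Theta_pos[OF Suc.prems] by (simp add: val_Cons)
qed

lemma psi_word_inj:
  assumes "i \<in> {1..k}" "set w \<subseteq> {1..k}" "set w' \<subseteq> {1..k}" "x \<in> V0" "x' \<in> V0"
    "psi_word \<psi> (i # w) x = psi_word \<psi> (i # w') x'"
  shows "psi_word \<psi> w x = psi_word \<psi> w' x'"
  using inj_onD[OF psi_inj[OF assms(1)]] psi_word_in_F assms V_zero_subset by (simp add: subset_iff)

text \<open>If the words begin with different letters, the common point lies in two different cells of
  level 1, so it is a vertex of both. Its value is then prescribed by the extension to the first
  level, whatever the representation.\<close>

lemma val_consistent_same_length: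
  assumes "u \<in> extensional V0" "w \<in> words k n" "w' \<in> words k n" "x \<in> V0" "x' \<in> V0"
    "psi_word \<psi> w x = psi_word \<psi> w' x'"
  shows "val u w x = val u w' x'"
  using assms
proof (induction n arbitrary: u w w' x x')
  case 0
  then show ?case by (simp add: words_0 val_Nil)
next
  case (Suc n)
  obtain i v where iv: "w = i # v" "i \<in> {1..k}" "v \<in> words k n" using Suc.prems(2) by (auto simp: words_Suc)
  obtain i' v' where iv': "w' = i' # v'" "i' \<in> {1..k}" "v' \<in> words k n"
    using Suc.prems(3) by (auto simp: words_Suc)
  have vk: "set v \<subseteq> {1..k}" "set v' \<subseteq> {1..k}" using iv iv' by (auto simp: words_def)
  show ?case
  proof (cases "i = i'")
    case True
    have "psi_word \<psi> v x = psi_word \<psi> v' x'"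
      using psi_word_inj[OF iv(2) vk Suc.prems(4,5)] Suc.prems(6) iv(1) iv'(1) True by simp
    then have "val (child u i) v x = val (child u i) v' x'"
      by (intro Suc.IH child_extensional iv(3) iv'(3) Suc.prems(4,5))
    then show ?thesis using iv(1) iv'(1) True by (simp add: val_Cons)
  next
    case False
    have inF: "psi_word \<psi> v x \<in> F" "psi_word \<psi> v' x' \<in> F"
      using psi_word_in_F vk Suc.prems(4,5) V_zero_subset by blast+
    have "[i] \<in> words k 1" "[i'] \<in> words k 1" "[i] \<noteq> [i']"
      using iv(2) iv'(2) False by (auto simp: words_def)
    from cell_inter[OF this] have inter: "\<psi> i ` F \<inter> \<psi> i' ` F = \<psi> i ` V0 \<inter> \<psi> i' ` V0" by simp
    have eq: "\<psi> i (psi_word \<psi> v x) = \<psi> i' (psi_word \<psi> v' x')"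
      using Suc.prems(6) iv(1) iv'(1) by simp
    have vertex: "psi_word \<psi> v x \<in> V0 \<and> psi_word \<psi> v' x' \<in> V0"
    proof -
      have "\<psi> i (psi_word \<psi> v x) \<in> \<psi> i ` V0 \<inter> \<psi> i' ` V0"
        using inter eq inF by (metis Int_iff image_eqI)
      then obtain y y' where y: "y \<in> V0" "\<psi> i (psi_word \<psi> v x) = \<psi> i y"
        "y' \<in> V0" "\<psi> i' (psi_word \<psi> v' x') = \<psi> i' y'" using eq by auto
      have "psi_word \<psi> v x = y" "psi_word \<psi> v' x' = y'"
        using inj_onD[OF psi_inj[OF iv(2)] y(2) inF(1)] inj_onD[OF psi_inj[OF iv'(2)] y(4) inF(2)]
          y(1,3) V_zero_subset by blast+
      then show ?thesis using y by simp
    qed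
    have at_vertex: "val (child u l) r a = Z u (\<psi> l (psi_word \<psi> r a))"
      if l: "r \<in> words k n" and a: "a \<in> V0" "psi_word \<psi> r a \<in> V0" for l r a
    proof -
      obtain j where j: "j \<in> {1..N}" "psi_word \<psi> r a = P j" using a(2) by (auto simp: V_zero_def)
      have "replicate n j \<in> words k n" using j(1) N_le_k by (auto simp: words_def)
      moreover have "psi_word \<psi> r a = psi_word \<psi> (replicate n j) (P j)"
        using psi_word_replicate_corner[OF j(1)] j(2) by simp
      ultimately have "val (child u l) r a = val (child u l) (replicate n j) (P j)"
        by (intro Suc.IH child_extensional l a(1) P_in_V0[OF j(1)])
      also have "\<dots> = child u l (P j)" by (rule val_replicate_corner[OF j(1) child_extensional])
      finally show ?thesis using P_in_V0[OF j(1)] j(2) by (simp add: child_def)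
    qed
    show ?thesis
      using at_vertex[OF iv(3) Suc.prems(4), of i] at_vertex[OF iv'(3) Suc.prems(5), of i'] vertex eq
      unfolding iv(1) iv'(1) val_Cons by simp
  qed
qed

text \<open>A vertex \<open>P j\<close> is fixed by \<open>\<psi> j\<close>, so words may be prolonged by the letter \<open>j\<close> without
  changing the point or the value. This reduces questions about vertices of different levels to a
  common level.\<close>

lemma pad_word:
  assumes u: "u \<in> extensional V0" and w: "set w \<subseteq> {1..k}" and x: "x \<in> V0"
  obtains r where "set r \<subseteq> {1..k}" "length r = m"
    "psi_word \<psi> (w @ r) x = psi_word \<psi> w x" "val u (w @ r) x = val u w x"
proof -
  obtain j where j: "j \<in> {1..N}" "x = P j" using x by (auto simp: V_zero_def)
  have "set (replicate m j) \<subseteq> {1..k}" using j(1) N_le_k by auto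
  moreover have "psi_word \<psi> (w @ replicate m j) x = psi_word \<psi> w x"
    by (simp add: psi_word_append j(2) psi_word_replicate_corner[OF j(1)])
  moreover have "val u (w @ replicate m j) x = val u w x"
    unfolding val_append j(2) val_replicate_corner[OF j(1) state_extensional[OF u]]
    by (simp add: val_def)
  ultimately show thesis using that[of "replicate m j"] by simp
qed

lemma val_consistent:
  assumes u: "u \<in> extensional V0" and w: "set w \<subseteq> {1..k}" "set w' \<subseteq> {1..k}"
    and x: "x \<in> V0" "x' \<in> V0" and eq: "psi_word \<psi> w x = psi_word \<psi> w' x'"
  shows "val u w x = val u w' x'"
proof -
  obtain r where r: "set r \<subseteq> {1..k}" "length r = length w'"
    "psi_word \<psi> (w @ r) x = psi_word \<psi> w x" "val u (w @ r) x = val u w x"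
    by (rule pad_word[OF u w(1) x(1)])
  obtain r' where r': "set r' \<subseteq> {1..k}" "length r' = length w"
    "psi_word \<psi> (w' @ r') x' = psi_word \<psi> w' x'" "val u (w' @ r') x' = val u w' x'"
    by (rule pad_word[OF u w(2) x(2)])
  have "val u (w @ r) x = val u (w' @ r') x'"
    using r r' w eq
    by (intro val_consistent_same_length[OF u _ _ x, where n = "length w + length w'"])
      (auto simp: words_def)
  then show ?thesis using r r' by simp
qed

definition sol :: "('a \<Rightarrow> real) \<Rightarrow> 'a \<Rightarrow> real" where
  "sol u y = (SOME c. \<exists>w x. set w \<subseteq> {1..k} \<and> x \<in> V0 \<and> y = psi_word \<psi> w x \<and> c = val u w x)"

lemma sol_psi_word:
  assumes "u \<in> extensional V0" "set w \<subseteq> {1..k}" "x \<in> V0"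
  shows "sol u (psi_word \<psi> w x) = val u w x"
  unfolding sol_def
proof (rule some_equality)
  fix c assume "\<exists>w' x'. set w' \<subseteq> {1..k} \<and> x' \<in> V0 \<and> psi_word \<psi> w x = psi_word \<psi> w' x' \<and> c = val u w' x'"
  then show "c = val u w x" using val_consistent[OF assms(1,2) _ assms(3)] by metis
qed (use assms in blast)

section \<open>Continuous extension and energy\<close>

text \<open>Nearby vertices lie in the same cell or in two cells that meet, and cells meet at common
  vertices only.\<close>

lemma uniformly_continuous_sol:
  assumes u: "u \<in> extensional V0"
  shows "uniformly_continuous_on (V_infty k \<psi> V0) (sol u)"
  unfolding uniformly_continuous_on_def
proof (intro allI impI)
  fix e :: real assume e: "0 < e"
  obtain n where n: "\<And>w. w \<in> words k n \<Longrightarrow> osc V0 (val u w) < e / 2"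
    using osc_val_uniform_decay[OF u, of "e / 2"] e by (metis half_gt_zero)
  define c where "c w = psi_word \<psi> w ` F" for w
  define Q where "Q = {(w, w') \<in> words k n \<times> words k n. c w \<inter> c w' = {}}"
  have "finite Q"
    by (rule finite_subset[of _ "words k n \<times> words k n"]) (auto simp: Q_def finite_words)
  have "\<forall>q\<in>Q. \<exists>d>0. \<forall>x\<in>c (fst q). \<forall>y\<in>c (snd q). d \<le> dist x y"
  proof
    fix q assume q: "q \<in> Q"
    have "compact (c (fst q))" "compact (c (snd q))"
      unfolding c_def using q by (auto intro!: compact_cell simp: Q_def words_def)
    moreover have "c (fst q) \<inter> c (snd q) = {}" using q by (auto simp: Q_def)
    ultimately show "\<exists>d>0. \<forall>x\<in>c (fst q). \<forall>y\<in>c (snd q). d \<le> dist x y"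
      by (metis compact_disjoint_separated)
  qed
  then obtain d where d: "\<And>q. q \<in> Q \<Longrightarrow> 0 < d q"
    "\<And>q x y. q \<in> Q \<Longrightarrow> x \<in> c (fst q) \<Longrightarrow> y \<in> c (snd q) \<Longrightarrow> d q \<le> dist x y"
    by metis
  define r where "r = Min (insert 1 (d ` Q))"
  have r: "0 < r" unfolding r_def using \<open>finite Q\<close> d(1) by auto
  have cell: "\<exists>w\<in>words k n. y \<in> c w \<and> (\<forall>a\<in>V0. \<bar>sol u y - val u w a\<bar> < e / 2)"
    if "y \<in> V_infty k \<psi> V0" for y
  proof -
    obtain w x where w: "set w \<subseteq> {1..k}" "x \<in> V0" "y = psi_word \<psi> w x"
      using \<open>y \<in> V_infty k \<psi> V0\<close> unfolding V_infty_eq by blast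
    obtain s where s: "set s \<subseteq> {1..k}" "length s = n" "psi_word \<psi> (w @ s) x = psi_word \<psi> w x"
      by (rule pad_word[OF u w(1,2)])
    define w1 w2 where "w1 = take n (w @ s)" and "w2 = drop n (w @ s)"
    have ws: "w @ s = w1 @ w2" unfolding w1_def w2_def by (rule append_take_drop_id[symmetric])
    have sub: "set w1 \<subseteq> {1..k}" "set w2 \<subseteq> {1..k}" using w(1) s(1) ws
      by (metis Un_subset_iff set_append)+
    have w1: "w1 \<in> words k n" using sub s(2) by (simp add: words_def w1_def)
    have y: "y = psi_word \<psi> w1 (psi_word \<psi> w2 x)" using w(3) s(3) ws by (simp add: psi_word_append)
    have "y \<in> c w1" unfolding c_def y using psi_word_in_F[OF sub(2)] w(2) V_zero_subset by blast
    moreover have "sol u y = val u (w1 @ w2) x"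
      using sol_psi_word[OF u, of "w1 @ w2" x] sub w(2) y by (simp add: psi_word_append)
    then have "\<bar>sol u y - val u w1 a\<bar> < e / 2" if "a \<in> V0" for a
      using val_subcell_close[OF u sub(2) w(2) that, of w1] n[OF w1] by simp
    ultimately show ?thesis using w1 by blast
  qed
  have "dist (sol u y') (sol u y) < e"
    if y: "y \<in> V_infty k \<psi> V0" "y' \<in> V_infty k \<psi> V0" and near: "dist y' y < r" for y y'
  proof -
    obtain w where w: "w \<in> words k n" "y \<in> c w" "\<And>a. a \<in> V0 \<Longrightarrow> \<bar>sol u y - val u w a\<bar> < e / 2"
      using cell[OF y(1)] by blast
    obtain w' where w': "w' \<in> words k n" "y' \<in> c w'" "\<And>a. a \<in> V0 \<Longrightarrow> \<bar>sol u y' - val u w' a\<bar> < e / 2"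
      using cell[OF y(2)] by blast
    have "\<exists>a\<in>V0. \<exists>a'\<in>V0. val u w a = val u w' a'"
    proof (cases "w = w'")
      case True
      then show ?thesis using neV by blast
    next
      case False
      have "(w, w') \<notin> Q"
      proof
        assume q: "(w, w') \<in> Q"
        then have "d (w, w') \<le> dist y y'" using d(2)[OF q] w(2) w'(2) by simp
        moreover have "r \<le> d (w, w')" unfolding r_def using q \<open>finite Q\<close> by (intro Min_le) auto
        ultimately show False using near by (simp add: dist_commute)
      qed
      then have "c w \<inter> c w' \<noteq> {}" using w(1) w'(1) by (auto simp: Q_def)
      then have "psi_word \<psi> w ` V0 \<inter> psi_word \<psi> w' ` V0 \<noteq> {}"
        using cell_inter[OF w(1) w'(1) False] unfolding c_def by simp
      then obtain a a' where a: "a \<in> V0" "a' \<in> V0" "psi_word \<psi> w a = psi_word \<psi> w' a'" by blast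
      then show ?thesis
        using val_consistent_same_length[OF u w(1) w'(1) a] by blast
    qed
    then obtain a a' where "a \<in> V0" "a' \<in> V0" "val u w a = val u w' a'" by blast
    then show ?thesis using w(3)[of a] w'(3)[of a'] unfolding dist_real_def by linarith
  qed
  then show "\<exists>d>0. \<forall>x\<in>V_infty k \<psi> V0. \<forall>x'\<in>V_infty k \<psi> V0. dist x' x < d \<longrightarrow>
      dist (sol u x') (sol u x) < e"
    using r by blast
qed

text \<open>The factors in the nonlinear energy are defined from the function itself. Along the solution they
  are the ones it was built with, so the terms of the energy of level \<open>n\<close> are the energies of the
  data of level \<open>n\<close>.\<close>

lemma theta_word_eq_factor:
  assumes "u \<in> extensional V0" "set w \<subseteq> {1..k}"
    "\<And>w x. set w \<subseteq> {1..k} \<Longrightarrow> x \<in> V0 \<Longrightarrow> f (psi_word \<psi> w x) = val u w x"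
  shows "theta_word \<psi> V0 \<Theta> w f = factor w u"
  using assms
proof (induction w arbitrary: u f)
  case Nil
  then show ?case by simp
next
  case (Cons i w)
  have i: "i \<in> {1..k}" and w: "set w \<subseteq> {1..k}" using Cons.prems by auto
  have "restrict f V0 = u"
  proof
    fix x show "restrict f V0 x = u x"
      using Cons.prems(3)[of "[]" x] extensional_arb[OF Cons.prems(1), of x]
      by (auto simp: val_Nil restrict_def)
  qed
  moreover have "theta_word \<psi> V0 \<Theta> w (\<lambda>x. \<Theta> u * f (\<psi> i x)) = factor w (child u i)"
  proof (rule Cons.IH[OF child_extensional w])
    fix w' x assume "set w' \<subseteq> {1..k}" "x \<in> V0"
    then show "\<Theta> u * f (\<psi> i (psi_word \<psi> w' x)) = val (child u i) w' x"
      using Cons.prems(3)[of "i # w'" x] i Theta_pos[OF Cons.prems(1)] by (simp add: val_Cons)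
  qed
  ultimately show ?case by simp
qed

lemma energy_n_sol:
  assumes u: "u \<in> extensional V0"
    and f: "\<And>w x. set w \<subseteq> {1..k} \<Longrightarrow> x \<in> V0 \<Longrightarrow> f (psi_word \<psi> w x) = val u w x"
  shows "energy_n k \<psi> V0 \<sigma> E n f = E u"
proof -
  have "E (\<lambda>x\<in>V0. theta_word \<psi> V0 \<Theta> w f * f (psi_word \<psi> w x)) = E (state w u)"
    if "w \<in> words k n" for w
  proof -
    have wk: "set w \<subseteq> {1..k}" using that by (simp add: words_def)
    have "(\<lambda>x\<in>V0. theta_word \<psi> V0 \<Theta> w f * f (psi_word \<psi> w x)) = restrict (state w u) V0"
      using theta_word_eq_factor[OF u wk f] f[OF wk] factor_pos[OF u, of w]
      by (intro restrict_ext) (simp add: val_def)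
    then show ?thesis using state_extensional[OF u] by (simp add: extensional_restrict)
  qed
  then have "energy_n k \<psi> V0 \<sigma> E n f = (1 / \<sigma> ^ n) * (\<Sum>w\<in>words k n. E (state w u))"
    unfolding energy_n_def by simp
  also have "\<dots> = E u" using sum_energy_state[OF u, of n] sigma by simp
  finally show ?thesis .
qed

lemma extension_with_same_energy:
  assumes u: "u \<in> extensional V0"
  shows "\<exists>v \<in> ext_L' V0 F u. energy_infty k \<psi> V0 \<sigma> E (restrict v (V_infty k \<psi> V0)) = ereal (E u)"
proof -
  obtain g where g: "uniformly_continuous_on F g" "\<And>y. y \<in> V_infty k \<psi> V0 \<Longrightarrow> sol u y = g y"
    using uniformly_continuous_on_extension_on_closure[OF uniformly_continuous_sol[OF u]]
    unfolding closure_V_infty by metis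
  have gval: "g (psi_word \<psi> w x) = val u w x" if "set w \<subseteq> {1..k}" "x \<in> V0" for w x
  proof -
    have "psi_word \<psi> w x \<in> V_infty k \<psi> V0" using that unfolding V_infty_eq by blast
    then show ?thesis using g(2) sol_psi_word[OF u that] by metis
  qed
  have cont: "continuous_on (closure (V_infty k \<psi> V0)) g"
    unfolding closure_V_infty by (rule uniformly_continuous_imp_continuous[OF g(1)])
  have bds: "Min (u ` V0) \<le> g y \<and> g y \<le> Max (u ` V0)" if "y \<in> F" for y
  proof -
    have "y \<in> closure (V_infty k \<psi> V0)" using that closure_V_infty by simp
    moreover have "Min (u ` V0) \<le> g y' \<and> g y' \<le> Max (u ` V0)" if "y' \<in> V_infty k \<psi> V0" for y'
      using that gval val_bounds[OF u] unfolding V_infty_eq by force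
    ultimately show ?thesis
      using continuous_ge_on_closure[OF cont] continuous_le_on_closure[OF cont] by blast
  qed
  define v where "v = restrict g F"
  have "continuous_on F v"
    unfolding v_def using uniformly_continuous_imp_continuous[OF g(1)]
    by (simp cong: continuous_on_cong)
  moreover have "v x = u x" if "x \<in> V0" for x
    using gval[of "[]" x] that V_zero_subset by (auto simp: v_def val_Nil)
  ultimately have "v \<in> ext_L' V0 F u"
    unfolding ext_L'_def using bds by (simp add: v_def)
  moreover have "restrict v (V_infty k \<psi> V0) (psi_word \<psi> w x) = val u w x"
    if "set w \<subseteq> {1..k}" "x \<in> V0" for w x
  proof -
    have "psi_word \<psi> w x \<in> V_infty k \<psi> V0" using that unfolding V_infty_eq by blast
    then show ?thesis using gval[OF that] V_infty_subset_F by (auto simp: v_def)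
  qed
  then have "energy_n k \<psi> V0 \<sigma> E n (restrict v (V_infty k \<psi> V0)) = E u" for n
    by (rule energy_n_sol[OF u])
  then have "energy_infty k \<psi> V0 \<sigma> E (restrict v (V_infty k \<psi> V0)) = ereal (E u)"
    unfolding energy_infty_def by (simp add: limI)
  ultimately show ?thesis by blast
qed

end

theorem theorem6p1:
  fixes N k :: nat
    and P :: "nat \<Rightarrow> 'a::metric_space"
    and \<psi> :: "nat \<Rightarrow> 'a \<Rightarrow> 'a"
    and F :: "'a set"
    and E :: "('a \<Rightarrow> real) \<Rightarrow> real"
    and \<sigma> :: real
    and u :: "'a \<Rightarrow> real"
  assumes "fractal N k P \<psi> F"
    and "E \<in> A4 k \<psi> (V_zero N P)"
    and "\<sigma> \<in> {0<..1}"
    and "u \<in> real_funs (V_zero N P)"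
  shows "\<exists>v \<in> ext_L' (V_zero N P) F u.
    energy_infty k \<psi> (V_zero N P) \<sigma> E (restrict v (V_infty k \<psi> (V_zero N P))) = ereal (E u)"
proof -
  interpret fractal N k P \<psi> F by (rule assms(1))
  have E: "energy_nonneg V0 E" "Q1 V0 E" "Q2 V0 E" "Q3 V0 E" "Q4 V0 E" "Q5 V0 E"
    using assms(2) by (auto simp: A4_def A3_def A1_def)
  obtain E' p \<rho> where W: "A2_witness k \<psi> V0 E E' p \<rho>"
    using assms(2) by (auto simp: A4_def A2_def)
  interpret nonlinear_energy N k P \<psi> F E E' p \<rho> \<sigma>
    using E W assms(3) by unfold_locales (auto simp: A2_witness_def Q4_def)
  show ?thesis by (rule extension_with_same_energy[OF assms(4)])
qed

end
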